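(* For every integer $r\geq 3$, there exists an infinite $r$-differential poset $P^{(r)}$ such that \[ |P^{(r)}_i|=|(Y^r)_i|\quad(0\leq i\leq 3), \qquad |P^{(r)}_4|=|(Y^r)_4|-\left\lfloor\frac r3\right\rfloor . \] Moreover, for every integer $r\ge 3$, \[ |(Y^r)_4|=\frac{r(r+1)(r^2+17r+42)}{24}. \] In particular, the first five rank sizes $(|P^{(3)}_0|,|P^{(3)}_1|,|P^{(3)}_2|,|P^{(3)}_3|,|P^{(3)}_4|)$ of $P^{(3)}$ are $(1,3,9,22,50)$, whereas the first five rank sizes of $Y^3$ are $(1,3,9,22,51)$.
   Context: Young's lattice $Y$ is the graded poset of all integer partitions (including the empty partition) ordered by inclusion of Ferrers diagrams; its rank-$n$ elements are the partitions of $n$, and a cover relation adds one cell. $Y^r$ denotes the Cartesian product of $r$ copies of $Y$ with the componentwise order; its rank-$n$ set $(Y^r)_n$ consists of the $r$-tuples of partitions whose total size is $n$. Let $r$ be a positive integer. An $r$-differential poset is a locally finite graded poset $P=\bigsqcup_{n\geq 0}P_n$ ($P_n$ being the set of elements of rank $n$) with a unique least element and the following properties. (D1) If $x\neq y$ have the same rank, then the number of their common upper covers (elements covering both $x$ and $y$) equals the number of their common lower covers (elements covered by both $x$ and $y$). (D2) If $x$ has $d$ lower covers, then it has $d+r$ upper covers. *)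

theory Defs
  imports Complex_Main "HOL-Algebra.Order" "HOL-Library.FuncSet"
begin

record 'a ranked_order = "'a gorder" +
  rank :: "'a \<Rightarrow> nat"

definition rank_set :: "('a, 'm) ranked_order_scheme \<Rightarrow> nat \<Rightarrow> 'a set" where
  "rank_set P n = {x \<in> carrier P. rank P x = n}"

definition rank_size :: "('a, 'm) ranked_order_scheme \<Rightarrow> nat \<Rightarrow> nat" where
  "rank_size P n = card (rank_set P n)"

definition covers :: "('a, 'm) gorder_scheme \<Rightarrow> 'a \<Rightarrow> 'a \<Rightarrow> bool" where
  "covers P y x \<longleftrightarrow> x \<in> carrier P \<and> y \<in> carrier P \<and> x \<sqsubset>\<^bsub>P\<^esub> y \<and>
     \<not> (\<exists>z \<in> carrier P. x \<sqsubset>\<^bsub>P\<^esub> z \<and> z \<sqsubset>\<^bsub>P\<^esub> y)"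

definition upper_covers :: "('a, 'm) gorder_scheme \<Rightarrow> 'a \<Rightarrow> 'a set" where
  "upper_covers P x = {y. covers P y x}"

definition lower_covers :: "('a, 'm) gorder_scheme \<Rightarrow> 'a \<Rightarrow> 'a set" where
  "lower_covers P x = {y. covers P x y}"

locale graded_poset = partial_order P
  for P :: "('a, 'm) ranked_order_scheme" (structure) +
  assumes rank_minimal:
      "\<lbrakk>x \<in> carrier P; \<not> (\<exists>y \<in> carrier P. y \<sqsubset> x)\<rbrakk> \<Longrightarrow> rank P x = 0"
    and rank_strict_mono:
      "\<lbrakk>x \<in> carrier P; y \<in> carrier P; x \<sqsubset> y\<rbrakk> \<Longrightarrow> rank P x < rank P y"
    and rank_covers: "covers P y x \<Longrightarrow> rank P y = Suc (rank P x)"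

text \<open>
  In \<open>D2\<close> the set of lower covers is finite by local finiteness and the existence of a least
  element; for the upper covers finiteness is part of the requirement.
\<close>

locale differential_poset = graded_poset P
  for r :: nat and P :: "('a, 'm) ranked_order_scheme" (structure) +
  assumes r_pos: "0 < r"
    and locally_finite: "\<lbrakk>x \<in> carrier P; y \<in> carrier P\<rbrakk> \<Longrightarrow> finite \<lbrace>x..y\<rbrace>"
    and unique_least: "\<exists>!b. least P b (carrier P)"
    and D1: "\<lbrakk>x \<in> carrier P; y \<in> carrier P; x \<noteq> y; rank P x = rank P y\<rbrakk> \<Longrightarrow>
      card (upper_covers P x \<inter> upper_covers P y) = card (lower_covers P x \<inter> lower_covers P y)"
    and D2: "x \<in> carrier P \<Longrightarrow>
      finite (upper_covers P x) \<and> card (upper_covers P x) = card (lower_covers P x) + r"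

text \<open>
  A partition is encoded as its weakly decreasing sequence of parts, padded with zeros to an
  infinite sequence.
\<close>

definition partitions :: "(nat \<Rightarrow> nat) set" where
  "partitions = {p. antimono p \<and> finite {i. p i \<noteq> 0}}"

definition partition_size :: "(nat \<Rightarrow> nat) \<Rightarrow> nat" where
  "partition_size p = (\<Sum>i | p i \<noteq> 0. p i)"

definition ferrers :: "(nat \<Rightarrow> nat) \<Rightarrow> (nat \<times> nat) set" where
  "ferrers p = {(i, j). j < p i}"

definition young :: "(nat \<Rightarrow> nat) ranked_order" where
  "young = \<lparr>carrier = partitions, eq = (=),
     le = (\<lambda>p q. ferrers p \<subseteq> ferrers q), rank = partition_size\<rparr>"

text \<open>
  The product of \<open>r\<close> copies of a ranked poset; \<open>r\<close>-tuples are functions on \<open>{..<r}\<close>, extended by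
  \<^const>\<open>undefined\<close> outside that set.
\<close>

definition ranked_power :: "('a, 'm) ranked_order_scheme \<Rightarrow> nat \<Rightarrow> (nat \<Rightarrow> 'a) ranked_order" where
  "ranked_power P r = \<lparr>carrier = {..<r} \<rightarrow>\<^sub>E carrier P, eq = (=),
     le = (\<lambda>f g. \<forall>i<r. f i \<sqsubseteq>\<^bsub>P\<^esub> g i), rank = (\<lambda>f. \<Sum>i<r. rank P (f i))\<rparr>"

end

theory Submission
  imports Defs "HOL-Library.Nat_Bijection"
begin

text \<open>
  In terms of its levels, a poset is \<open>r\<close>-differential if for all \<open>x\<close>, \<open>y\<close> of the same rank the
  number of common upper covers is the number of common lower covers, plus \<open>r\<close> if \<open>x = y\<close>. So the
  next rank is a family of nonempty blocks (sets of lower covers) on the current one, in which every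
  pair and every point lies in a prescribed number of blocks, and any such family will do. Wagner's
  reflection always supplies one (\<open>incidence_step_reflect\<close>). Hence a poset given up to rank \<open>4\<close>
  extends to an infinite one, and only the first five ranks have to be built.

  Up to rank \<open>3\<close> they are those of \<open>Y\<^sup>r\<close>. For rank \<open>4\<close>, take the blocks that belong to \<open>Y\<^sup>r\<close> and
  replace some of them by others that contain each pair and each point equally often. Breaking a
  block of three points into its three pairs keeps the pair counts and puts each of the three points
  into one block more; if these points have singleton blocks, dropping those restores the point
  counts, and four blocks have become three. No block of \<open>Y\<^sup>r\<close> with three points admits this directly,
  because singleton blocks belong to \<open>4\<close>, \<open>22\<close> and \<open>1111\<close> in one component and so exist only on the
  points \<open>3\<close>, \<open>21\<close> and \<open>111\<close>. But the rearrangement below of ten blocks with two or three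
  points, on three components, has the same net effect on the points \<open>21\<close> of these components.
  Dropping the three blocks of \<open>22\<close> then saves one element (\<open>swap_identity\<close>). Exchanges on disjoint
  triples of components do not interfere (\<open>shapes_tuple_disjoint\<close>), which saves \<open>\<lfloor>r / 3\<rfloor>\<close>
  elements.

  That \<open>Y\<^sup>r\<close> itself has the required counts is modularity for \<open>x \<noteq> y\<close>
  (\<open>card_common_upper_eq_lower\<close>), and for \<open>x = y\<close> the fact that a partition has one addable cell
  more than it has removable ones (\<open>addable_eq\<close>). Its rank sizes follow from the partition numbers by
  convolution (\<open>rank_size_young_power_Suc\<close>).
\<close>

section \<open>Posets built level by level\<close>

text \<open>
  One level of a differential poset. The \<open>k\<close>-th entry of \<open>A\<close> is the set of (indices of) lower covers
  of the \<open>k\<close>-th element of that level, and \<open>B\<close> describes the next level in the same way. Lists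
  are needed here, as several elements may have the same lower covers. The counting clause is
  \<open>DU - UD = r I\<close>: its off-diagonal part is D1 and its diagonal part is D2.
\<close>

definition incidence_step :: "nat \<Rightarrow> nat set list \<Rightarrow> nat set list \<Rightarrow> bool" where
  "incidence_step r A B \<longleftrightarrow>
     (\<forall>S\<in>set B. S \<noteq> {} \<and> S \<subseteq> {..<length A}) \<and>
     (\<forall>k<length A. \<forall>l<length A.
        length (filter (\<lambda>S. k \<in> S \<and> l \<in> S) B) = card (A ! k \<inter> A ! l) + (if k = l then r else 0))"

lemma incidence_step_count:
  "incidence_step r A B \<Longrightarrow> k < length A \<Longrightarrow> l < length A \<Longrightarrow>
   length (filter (\<lambda>S. k \<in> S \<and> l \<in> S) B) = card (A ! k \<inter> A ! l) + (if k = l then r else 0)"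
  by (simp add: incidence_step_def)

text \<open>
  The \<open>k\<close>-th element of level \<open>n\<close> is the number \<^term>\<open>prod_encode (n, k)\<close>.
\<close>

definition level :: "nat \<Rightarrow> nat" where "level a = fst (prod_decode a)"
definition position :: "nat \<Rightarrow> nat" where "position a = snd (prod_decode a)"

lemma level_encode [simp]: "level (prod_encode (n, k)) = n"
  and position_encode [simp]: "position (prod_encode (n, k)) = k"
  by (simp_all add: level_def position_def)

lemma encode_level_position [simp]: "prod_encode (level a, position a) = a"
  by (simp add: level_def position_def)

lemma eq_if_level_position: "level a = level b \<Longrightarrow> position a = position b \<Longrightarrow> a = b"
  by (metis encode_level_position)

lemma elements_on_level:
  "{a. level a = n \<and> position a \<in> K} = (\<lambda>k. prod_encode (n, k)) ` K"
  by (auto simp: image_iff) (metis encode_level_position)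

definition tower_covers :: "(nat \<Rightarrow> nat set list) \<Rightarrow> nat \<Rightarrow> nat \<Rightarrow> bool" where
  "tower_covers T a b \<longleftrightarrow> level b = Suc (level a) \<and> position b < length (T (level b)) \<and>
     position a \<in> T (level b) ! position b"

definition tower_poset :: "(nat \<Rightarrow> nat set list) \<Rightarrow> nat ranked_order" where
  "tower_poset T = \<lparr>carrier = {a. position a < length (T (level a))}, eq = (=),
     le = (tower_covers T)\<^sup>*\<^sup>*, rank = level\<rparr>"

lemma tower_poset_simps [simp]:
  "carrier (tower_poset T) = {a. position a < length (T (level a))}"
  "eq (tower_poset T) = (=)"
  "le (tower_poset T) = (tower_covers T)\<^sup>*\<^sup>*"
  "rank (tower_poset T) = level"
  by (simp_all add: tower_poset_def)

lemma tower_poset_lless: "a \<sqsubset>\<^bsub>tower_poset T\<^esub> b \<longleftrightarrow> (tower_covers T)\<^sup>*\<^sup>* a b \<and> a \<noteq> b"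
  by (simp add: lless_def)

lemma rank_size_tower_poset: "rank_size (tower_poset T) n = length (T n)"
proof -
  have "rank_set (tower_poset T) n = {a. level a = n \<and> position a \<in> {..<length (T n)}}"
    by (auto simp: rank_set_def)
  then have "rank_set (tower_poset T) n = (\<lambda>k. prod_encode (n, k)) ` {..<length (T n)}"
    by (simp only: elements_on_level)
  moreover have "inj_on (\<lambda>k. prod_encode (n, k)) {..<length (T n)}"
    by (auto simp: inj_on_def)
  ultimately show ?thesis
    by (simp add: rank_size_def card_image)
qed

lemma tower_path_level: "(tower_covers T)\<^sup>*\<^sup>* a b \<Longrightarrow> a = b \<or> level a < level b"
  by (induction rule: rtranclp_induct) (auto simp: tower_covers_def)

lemma tower_covers_lless: "tower_covers T a b \<Longrightarrow> a \<sqsubset>\<^bsub>tower_poset T\<^esub> b"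
  by (metis n_not_Suc_n r_into_rtranclp tower_covers_def tower_poset_lless)

locale tower =
  fixes r :: nat and T :: "nat \<Rightarrow> nat set list"
  assumes bottom: "T 0 = [{}]"
    and step: "incidence_step r (T n) (T (Suc n))"
    and r_pos: "0 < r"
begin

lemma block: "k < length (T (Suc n)) \<Longrightarrow> T (Suc n) ! k \<noteq> {} \<and> T (Suc n) ! k \<subseteq> {..<length (T n)}"
  using step[of n] by (simp add: incidence_step_def)

lemma common_blocks:
  "k < length (T n) \<Longrightarrow> l < length (T n) \<Longrightarrow>
   length (filter (\<lambda>S. k \<in> S \<and> l \<in> S) (T (Suc n))) =
   card (T n ! k \<inter> T n ! l) + (if k = l then r else 0)"
  using step by (rule incidence_step_count)

lemma tower_covers_carrier:
  "tower_covers T a b \<Longrightarrow> a \<in> carrier (tower_poset T) \<and> b \<in> carrier (tower_poset T)"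
  using block by (fastforce simp: tower_covers_def)

text \<open>
  A cover step climbs one level, so no element fits strictly between its ends; conversely the first
  step of a path from \<open>a\<close> to \<open>b\<close> already ends in \<open>b\<close> if nothing lies strictly between \<open>a\<close> and \<open>b\<close>.
\<close>

lemma covers_tower_poset: "covers (tower_poset T) b a \<longleftrightarrow> tower_covers T a b"
proof
  assume cov: "tower_covers T a b"
  have "\<not> (a \<sqsubset>\<^bsub>tower_poset T\<^esub> z \<and> z \<sqsubset>\<^bsub>tower_poset T\<^esub> b)" for z
  proof
    assume "a \<sqsubset>\<^bsub>tower_poset T\<^esub> z \<and> z \<sqsubset>\<^bsub>tower_poset T\<^esub> b"
    then have "level a < level z" "level z < level b"
      using tower_path_level[of T] by (auto simp: tower_poset_lless)
    with cov show False by (simp add: tower_covers_def)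
  qed
  moreover have "a \<sqsubset>\<^bsub>tower_poset T\<^esub> b"
    using cov by (rule tower_covers_lless)
  ultimately show "covers (tower_poset T) b a"
    using tower_covers_carrier[OF cov] by (simp add: covers_def)
next
  assume cov: "covers (tower_poset T) b a"
  then have "(tower_covers T)\<^sup>*\<^sup>* a b" "a \<noteq> b"
    by (auto simp: covers_def tower_poset_lless)
  then obtain c where c: "tower_covers T a c" "(tower_covers T)\<^sup>*\<^sup>* c b"
    by (cases rule: converse_rtranclpE) auto
  have "c = b"
  proof (rule ccontr)
    assume "c \<noteq> b"
    then have "a \<sqsubset>\<^bsub>tower_poset T\<^esub> c" "c \<sqsubset>\<^bsub>tower_poset T\<^esub> b"
      using c tower_covers_lless by (auto simp: tower_poset_lless)
    then show False
      using cov tower_covers_carrier[OF c(1)] unfolding covers_def by blast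
  qed
  with c show "tower_covers T a b" by simp
qed

lemma tower_lower_cover_exists:
  assumes "a \<in> carrier (tower_poset T)" "level a = Suc n"
  obtains b where "tower_covers T b a" "level b = n"
proof -
  from assms block obtain k where "k \<in> T (Suc n) ! position a" by fastforce
  with assms that[of "prod_encode (n, k)"] show thesis by (simp add: tower_covers_def)
qed

lemma tower_bottom_least:
  "a \<in> carrier (tower_poset T) \<Longrightarrow> (tower_covers T)\<^sup>*\<^sup>* (prod_encode (0, 0)) a"
proof (induction "level a" arbitrary: a)
  case 0
  then have "level a = 0" by metis
  with 0(2) bottom have "a = prod_encode (0, 0)"
    by (simp add: eq_if_level_position)
  then show ?case by simp
next
  case (Suc n)
  then obtain b where b: "tower_covers T b a" "level b = n"
    using tower_lower_cover_exists[OF Suc(3), of n] by metis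
  then show ?case
    using Suc(1)[of b] tower_covers_carrier[OF b(1)] by (simp add: rtranclp.rtrancl_into_rtrancl)
qed

text \<open>
  The incidence identity of the tower, read in the poset. On the bottom level there are no lower
  covers, which agrees with the empty entry of the tower.
\<close>

lemma card_common_upper_covers:
  assumes "x \<in> carrier (tower_poset T)" "y \<in> carrier (tower_poset T)" "level x = level y"
  shows "finite (upper_covers (tower_poset T) x \<inter> upper_covers (tower_poset T) y)"
    and "card (upper_covers (tower_poset T) x \<inter> upper_covers (tower_poset T) y) =
      card (lower_covers (tower_poset T) x \<inter> lower_covers (tower_poset T) y) +
      (if x = y then r else 0)"
proof -
  define n where "n = level x"
  let ?k = "position x" and ?l = "position y"
  have kl: "?k < length (T n)" "?l < length (T n)"
    using assms by (auto simp: n_def)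
  let ?U = "{m. m < length (T (Suc n)) \<and> ?k \<in> T (Suc n) ! m \<and> ?l \<in> T (Suc n) ! m}"
  have up: "upper_covers (tower_poset T) x \<inter> upper_covers (tower_poset T) y =
      (\<lambda>m. prod_encode (Suc n, m)) ` ?U"
    unfolding elements_on_level[symmetric] using assms(3) n_def
    by (auto simp: upper_covers_def covers_tower_poset tower_covers_def)
  show "finite (upper_covers (tower_poset T) x \<inter> upper_covers (tower_poset T) y)"
    unfolding up by simp
  have "card (upper_covers (tower_poset T) x \<inter> upper_covers (tower_poset T) y) = card ?U"
    unfolding up by (rule card_image) (auto simp: inj_on_def)
  also have "\<dots> = length (filter (\<lambda>S. ?k \<in> S \<and> ?l \<in> S) (T (Suc n)))"
    by (simp add: length_filter_conv_card)
  also have "\<dots> = card (T n ! ?k \<inter> T n ! ?l) + (if ?k = ?l then r else 0)"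
    using kl by (rule common_blocks)
  also have "card (T n ! ?k \<inter> T n ! ?l) =
      card (lower_covers (tower_poset T) x \<inter> lower_covers (tower_poset T) y)"
  proof (cases n)
    case 0
    then have "T n ! ?k = {}" using kl bottom by simp
    moreover have "lower_covers (tower_poset T) x = {}"
      using 0 by (auto simp: lower_covers_def covers_tower_poset tower_covers_def n_def)
    ultimately show ?thesis by simp
  next
    case (Suc m)
    have "lower_covers (tower_poset T) x \<inter> lower_covers (tower_poset T) y =
        {a. level a = m \<and> position a \<in> T n ! ?k \<inter> T n ! ?l}"
      using assms Suc n_def
      by (auto simp: lower_covers_def covers_tower_poset tower_covers_def)
    then have "lower_covers (tower_poset T) x \<inter> lower_covers (tower_poset T) y =
        (\<lambda>i. prod_encode (m, i)) ` (T n ! ?k \<inter> T n ! ?l)"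
      by (simp only: elements_on_level)
    then show ?thesis
      by (simp add: card_image inj_on_def)
  qed
  also have "(?k = ?l) = (x = y)"
    using assms(3) eq_if_level_position by auto
  finally show "card (upper_covers (tower_poset T) x \<inter> upper_covers (tower_poset T) y) =
      card (lower_covers (tower_poset T) x \<inter> lower_covers (tower_poset T) y) +
      (if x = y then r else 0)" .
qed

lemma tower_level_nonempty: "0 < length (T n)"
proof (induction n)
  case 0
  then show ?case by (simp add: bottom)
next
  case (Suc n)
  have "length (filter (\<lambda>S. 0 \<in> S \<and> 0 \<in> S) (T (Suc n))) > 0"
    using common_blocks[OF Suc Suc] r_pos by simp
  then show ?case by auto
qed

theorem differential_poset_tower: "differential_poset r (tower_poset T)"
proof
  show "x \<in> carrier (tower_poset T) \<Longrightarrow> y \<in> carrier (tower_poset T) \<Longrightarrow>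
    x \<sqsubseteq>\<^bsub>tower_poset T\<^esub> y \<Longrightarrow> y \<sqsubseteq>\<^bsub>tower_poset T\<^esub> x \<Longrightarrow> x .=\<^bsub>tower_poset T\<^esub> y" for x y
    using tower_path_level[of T x y] tower_path_level[of T y x] by auto
  show "rank (tower_poset T) x = 0"
    if x: "x \<in> carrier (tower_poset T)" and min: "\<not> (\<exists>y\<in>carrier (tower_poset T). y \<sqsubset>\<^bsub>tower_poset T\<^esub> x)" for x
  proof (rule ccontr)
    assume "rank (tower_poset T) x \<noteq> 0"
    then obtain n where "level x = Suc n" by (auto simp: gr0_conv_Suc)
    then obtain b where b: "tower_covers T b x"
      using x by (blast elim: tower_lower_cover_exists)
    then have "b \<sqsubset>\<^bsub>tower_poset T\<^esub> x"
      by (rule tower_covers_lless)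
    with min tower_covers_carrier[OF b] show False by blast
  qed
  show "rank (tower_poset T) x < rank (tower_poset T) y" if "x \<sqsubset>\<^bsub>tower_poset T\<^esub> y" for x y
    using that tower_path_level[of T x y] by (auto simp: tower_poset_lless)
  show "covers (tower_poset T) y x \<Longrightarrow> rank (tower_poset T) y = Suc (rank (tower_poset T) x)" for x y
    by (simp add: covers_tower_poset tower_covers_def)
  show "0 < r" by (rule r_pos)
  show "finite \<lbrace>x..y\<rbrace>\<^bsub>tower_poset T\<^esub>" for x y
  proof (rule finite_subset)
    show "\<lbrace>x..y\<rbrace>\<^bsub>tower_poset T\<^esub> \<subseteq> prod_encode ` (SIGMA n:{..level y}. {..<length (T n)})"
    proof
      fix z assume "z \<in> \<lbrace>x..y\<rbrace>\<^bsub>tower_poset T\<^esub>"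
      then have "level z \<le> level y" "position z < length (T (level z))"
        using tower_path_level[of T z y] by (auto simp: at_least_at_most_def)
      then have "(level z, position z) \<in> (SIGMA n:{..level y}. {..<length (T n)})" by simp
      then show "z \<in> prod_encode ` (SIGMA n:{..level y}. {..<length (T n)})"
        by (metis encode_level_position imageI)
    qed
  qed simp
  show "\<exists>!b. least (tower_poset T) b (carrier (tower_poset T))"
  proof
    show "least (tower_poset T) (prod_encode (0, 0)) (carrier (tower_poset T))"
      using tower_bottom_least bottom by (simp add: least_def)
  next
    fix b assume "least (tower_poset T) b (carrier (tower_poset T))"
    then have "(tower_covers T)\<^sup>*\<^sup>* b (prod_encode (0, 0))"
      using bottom by (simp add: least_def)
    then show "b = prod_encode (0, 0)"
      using tower_path_level[of T b "prod_encode (0, 0)"] by auto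
  qed
  show "card (upper_covers (tower_poset T) x \<inter> upper_covers (tower_poset T) y) =
      card (lower_covers (tower_poset T) x \<inter> lower_covers (tower_poset T) y)"
    if "x \<in> carrier (tower_poset T)" "y \<in> carrier (tower_poset T)" "x \<noteq> y"
      "rank (tower_poset T) x = rank (tower_poset T) y" for x y
    using card_common_upper_covers(2)[OF that(1,2)] that by simp
  show "finite (upper_covers (tower_poset T) x) \<and>
      card (upper_covers (tower_poset T) x) = card (lower_covers (tower_poset T) x) + r"
    if "x \<in> carrier (tower_poset T)" for x
    using card_common_upper_covers[OF that that refl] by simp
qed auto

theorem infinite_tower_poset: "infinite (carrier (tower_poset T))"
proof
  assume "finite (carrier (tower_poset T))"
  moreover have "range (\<lambda>n. prod_encode (n, 0)) \<subseteq> carrier (tower_poset T)"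
    using tower_level_nonempty by auto
  moreover have "inj (\<lambda>n. prod_encode (n, 0))"
    by (auto simp: inj_def)
  ultimately show False
    using finite_imageD finite_subset infinite_UNIV_nat by blast
qed

end

section \<open>Reflection\<close>

text \<open>
  Wagner's construction. Each element of the lower level \<open>A\<close> is reflected at \<open>B\<close> to a new element
  whose lower covers are the upper covers of the old one, and every element of \<open>B\<close> gets \<open>r\<close> further
  upper covers that lie above it alone.
\<close>

definition reflect :: "nat \<Rightarrow> nat set list \<Rightarrow> nat set list \<Rightarrow> nat set list" where
  "reflect r A B = map (\<lambda>i. {k. k < length B \<and> i \<in> B ! k}) [0..<length A] @
     concat (map (\<lambda>k. replicate r {k}) [0..<length B])"

lemma length_filter_concat: "length (filter P (concat xss)) = (\<Sum>xs\<leftarrow>xss. length (filter P xs))"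
  by (induction xss) auto

text \<open>
  Reflected elements are common upper covers of \<open>k\<close> and \<open>l\<close> exactly if they reflect common lower
  covers, and the remaining elements contribute \<open>r\<close> on the diagonal. As \<open>r > 0\<close>, the
  identity between \<open>A\<close> and \<open>B\<close> gives each element of \<open>A\<close> an upper cover, so that its reflection has
  a lower one.
\<close>

lemma incidence_step_reflect:
  assumes step: "incidence_step r A B" and "0 < r"
  shows "incidence_step r B (reflect r A B)"
  unfolding incidence_step_def
proof (intro conjI ballI allI impI)
  fix S assume "S \<in> set (reflect r A B)"
  then consider i where "i < length A" "S = {k. k < length B \<and> i \<in> B ! k}"
    | k where "k < length B" "S = {k}"
    by (auto simp: reflect_def split: if_splits)
  then have "S \<noteq> {} \<and> S \<subseteq> {..<length B}"
  proof cases
    case 1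
    have "length (filter (\<lambda>S. i \<in> S \<and> i \<in> S) B) > 0"
      using incidence_step_count[OF step 1(1) 1(1)] \<open>0 < r\<close> by simp
    then obtain S' where "S' \<in> set B" "i \<in> S'" 
      by (auto simp: filter_empty_conv)
    then show ?thesis using 1 by (auto simp: in_set_conv_nth)
  qed auto
  then show "S \<noteq> {}" "S \<subseteq> {..<length B}" by auto
next
  fix k l assume kl: "k < length B" "l < length B"
  let ?P = "\<lambda>S. k \<in> S \<and> l \<in> S"
  have "length (filter ?P (map (\<lambda>i. {k. k < length B \<and> i \<in> B ! k}) [0..<length A])) =
      card {i. i < length A \<and> i \<in> B ! k \<inter> B ! l}"
    unfolding length_filter_conv_card using kl by (intro arg_cong[where f = card] Collect_cong) auto
  also have "{i. i < length A \<and> i \<in> B ! k \<inter> B ! l} = B ! k \<inter> B ! l"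
    using step nth_mem[OF kl(1)] unfolding incidence_step_def by blast
  finally have old: "length (filter ?P (map (\<lambda>i. {k. k < length B \<and> i \<in> B ! k}) [0..<length A])) =
      card (B ! k \<inter> B ! l)" .
  have "length (filter ?P (concat (map (\<lambda>j. replicate r {j}) [0..<length B]))) =
      (\<Sum>j\<leftarrow>[0..<length B]. if k = j \<and> l = j then r else 0)"
    by (auto simp: length_filter_concat comp_def filter_replicate intro!: arg_cong[where f = sum_list])
  also have "\<dots> = (\<Sum>j<length B. if k = j \<and> l = j then r else 0)"
    by (simp add: interv_sum_list_conv_sum_set_nat lessThan_atLeast0)
  also have "\<dots> = (\<Sum>j<length B. if k = j then (if k = l then r else 0) else 0)"
    by (intro sum.cong) auto
  also have "\<dots> = (if k = l then r else 0)"
    using kl by simp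
  finally show "length (filter ?P (reflect r A B)) =
      card (B ! k \<inter> B ! l) + (if k = l then r else 0)"
    using old by (simp add: reflect_def)
qed

fun reflection_tower :: "nat \<Rightarrow> nat \<Rightarrow> (nat \<Rightarrow> nat set list) \<Rightarrow> nat \<Rightarrow> nat set list" where
  "reflection_tower r N T n = (if n \<le> N then T n
     else reflect r (reflection_tower r N T (n - 2)) (reflection_tower r N T (n - 1)))"

declare reflection_tower.simps [simp del]

lemma tower_reflection_tower:
  assumes "T 0 = [{}]" and step: "\<And>n. n < N \<Longrightarrow> incidence_step r (T n) (T (Suc n))"
    and "0 < r" "0 < N"
  shows "tower r (reflection_tower r N T)"
proof
  show "reflection_tower r N T 0 = [{}]"
    using assms(1) by (simp add: reflection_tower.simps)
  show "incidence_step r (reflection_tower r N T n) (reflection_tower r N T (Suc n))" for n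
  proof (induction n)
    case 0
    then show ?case
      using step[of 0] \<open>0 < N\<close> by (simp add: reflection_tower.simps)
  next
    case (Suc n)
    show ?case
    proof (cases "Suc n < N")
      case True
      then show ?thesis using step[of "Suc n"] by (simp add: reflection_tower.simps)
    next
      case False
      then have "reflection_tower r N T (Suc (Suc n)) =
          reflect r (reflection_tower r N T n) (reflection_tower r N T (Suc n))"
        by (subst reflection_tower.simps) simp
      then show ?thesis
        using incidence_step_reflect[OF Suc \<open>0 < r\<close>] by simp
    qed
  qed
qed fact

section \<open>Powers of Young's lattice\<close>

abbreviation young_power :: "nat \<Rightarrow> (nat \<Rightarrow> nat \<Rightarrow> nat) ranked_order" where
  "young_power r \<equiv> ranked_power young r"

abbreviation tuple_rank :: "nat \<Rightarrow> (nat \<Rightarrow> nat \<Rightarrow> nat) \<Rightarrow> nat" where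
  "tuple_rank r f \<equiv> (\<Sum>i<r. partition_size (f i))"

lemma young_power_simps [simp]:
  "carrier (young_power r) = {..<r} \<rightarrow>\<^sub>E partitions"
  "rank (young_power r) f = tuple_rank r f"
  by (simp_all add: ranked_power_def young_def)

lemma mem_rank_set_young_power:
  "f \<in> rank_set (young_power r) n \<longleftrightarrow> f \<in> {..<r} \<rightarrow>\<^sub>E partitions \<and> tuple_rank r f = n"
  by (simp add: rank_set_def)

lemma ferrers_subset_iff: "ferrers p \<subseteq> ferrers q \<longleftrightarrow> p \<le> q"
proof
  show "p \<le> q" if "ferrers p \<subseteq> ferrers q"
  proof (rule le_funI, rule ccontr)
    fix k assume "\<not> p k \<le> q k"
    then have "(k, q k) \<in> ferrers p" by (simp add: ferrers_def)
    with that show False by (auto simp: ferrers_def)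
  qed
qed (auto simp: ferrers_def le_fun_def intro: less_le_trans)

lemma ferrers_inject: "ferrers p = ferrers q \<Longrightarrow> p = q"
  by (metis antisym ferrers_subset_iff order_refl)

lemma
  assumes "p \<in> partitions"
  shows finite_ferrers: "finite (ferrers p)"
    and card_ferrers: "card (ferrers p) = partition_size p"
proof -
  have fin: "finite {i. p i \<noteq> 0}" using assms by (simp add: partitions_def)
  have eq: "ferrers p = (SIGMA i:{i. p i \<noteq> 0}. {..<p i})"
    by (auto simp: ferrers_def)
  show "finite (ferrers p)" "card (ferrers p) = partition_size p"
    using fin by (simp_all add: eq partition_size_def)
qed

text \<open>
  A tuple of partitions is determined by its finite set of cells; order and rank become inclusion
  and cardinality, meets and joins become intersections and unions.
\<close>

definition cells :: "nat \<Rightarrow> (nat \<Rightarrow> nat \<Rightarrow> nat) \<Rightarrow> (nat \<times> nat \<times> nat) set" where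
  "cells r f = (SIGMA i:{..<r}. ferrers (f i))"

lemma
  assumes "f \<in> {..<r} \<rightarrow>\<^sub>E partitions"
  shows finite_cells: "finite (cells r f)"
    and card_cells: "card (cells r f) = tuple_rank r f"
  using assms finite_ferrers card_ferrers by (auto simp: cells_def PiE_iff)

lemma le_young_power_iff: "(\<forall>i<r. ferrers (f i) \<subseteq> ferrers (g i)) \<longleftrightarrow> cells r f \<subseteq> cells r g"
  by (force simp: cells_def)

lemma cells_inject:
  assumes "f \<in> {..<r} \<rightarrow>\<^sub>E partitions" "g \<in> {..<r} \<rightarrow>\<^sub>E partitions" "cells r f = cells r g"
  shows "f = g"
proof (rule PiE_ext[OF assms(1,2)])
  fix i assume "i \<in> {..<r}"
  then have "ferrers (f i) = ferrers (g i)"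
    using assms(3) le_young_power_iff[of r f g] le_young_power_iff[of r g f] by auto
  then show "f i = g i" by (rule ferrers_inject)
qed

lemma antimono_nat_iff: "antimono (p :: nat \<Rightarrow> nat) \<longleftrightarrow> (\<forall>k. p (Suc k) \<le> p k)"
  by (auto simp: antimono_iff_le_Suc)

lemma partitions_sup_inf:
  assumes "p \<in> partitions" "q \<in> partitions"
  shows "sup p q \<in> partitions" "inf p q \<in> partitions"
proof -
  have "finite {i. p i \<noteq> 0}" "finite {i. q i \<noteq> 0}" "antimono p" "antimono q"
    using assms by (auto simp: partitions_def)
  moreover have "{i. sup p q i \<noteq> 0} \<subseteq> {i. p i \<noteq> 0} \<union> {i. q i \<noteq> 0}"
    "{i. inf p q i \<noteq> 0} \<subseteq> {i. p i \<noteq> 0} \<union> {i. q i \<noteq> 0}"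
    by (auto simp: sup_nat_def inf_nat_def max_def min_def split: if_splits)
  ultimately show "sup p q \<in> partitions" "inf p q \<in> partitions"
    by (auto simp: partitions_def antimono_nat_iff
        intro: finite_subset le_supI1 le_supI2 le_infI1 le_infI2)
qed

lemma ferrers_sup_inf:
  "ferrers (sup p q) = ferrers p \<union> ferrers q" "ferrers (inf p q) = ferrers p \<inter> ferrers q"
  by (auto simp: ferrers_def sup_nat_def inf_nat_def)

lemma cells_union:
  assumes "f \<in> {..<r} \<rightarrow>\<^sub>E partitions" "g \<in> {..<r} \<rightarrow>\<^sub>E partitions"
  obtains h where "h \<in> {..<r} \<rightarrow>\<^sub>E partitions" "cells r h = cells r f \<union> cells r g"
proof
  show "(\<lambda>i\<in>{..<r}. sup (f i) (g i)) \<in> {..<r} \<rightarrow>\<^sub>E partitions"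
    using assms by (auto intro!: partitions_sup_inf)
qed (auto simp: cells_def ferrers_sup_inf)

lemma cells_inter:
  assumes "f \<in> {..<r} \<rightarrow>\<^sub>E partitions" "g \<in> {..<r} \<rightarrow>\<^sub>E partitions"
  obtains h where "h \<in> {..<r} \<rightarrow>\<^sub>E partitions" "cells r h = cells r f \<inter> cells r g"
proof
  show "(\<lambda>i\<in>{..<r}. inf (f i) (g i)) \<in> {..<r} \<rightarrow>\<^sub>E partitions"
    using assms by (auto intro!: partitions_sup_inf)
qed (auto simp: cells_def ferrers_sup_inf)

text \<open>
  Covers are described by rank and inclusion of cells, so that unions and intersections of cells
  apply to them directly.
\<close>

definition lower :: "nat \<Rightarrow> (nat \<Rightarrow> nat \<Rightarrow> nat) \<Rightarrow> (nat \<Rightarrow> nat \<Rightarrow> nat) set" where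
  "lower r x = {w \<in> {..<r} \<rightarrow>\<^sub>E partitions. Suc (tuple_rank r w) = tuple_rank r x \<and> cells r w \<subseteq> cells r x}"

definition upper :: "nat \<Rightarrow> (nat \<Rightarrow> nat \<Rightarrow> nat) \<Rightarrow> (nat \<Rightarrow> nat \<Rightarrow> nat) set" where
  "upper r x = {z \<in> {..<r} \<rightarrow>\<^sub>E partitions. tuple_rank r z = Suc (tuple_rank r x) \<and> cells r x \<subseteq> cells r z}"

text \<open>
  Modularity: a common upper cover of \<open>x \<noteq> y\<close> can only be their join \<open>s\<close>, a common lower cover only
  their meet \<open>i\<close>, and \<open>|s| + |i| = 2 |x|\<close> shows that \<open>s\<close> is an upper cover exactly if \<open>i\<close> is a lower
  cover. So both numbers are \<open>1\<close> or both are \<open>0\<close>.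
\<close>

lemma card_common_upper_eq_lower:
  assumes x: "x \<in> {..<r} \<rightarrow>\<^sub>E partitions" and y: "y \<in> {..<r} \<rightarrow>\<^sub>E partitions"
    and "x \<noteq> y" and rank: "tuple_rank r x = tuple_rank r y"
  shows "card (upper r x \<inter> upper r y) = card (lower r x \<inter> lower r y)"
proof -
  note fin = finite_cells[OF x] finite_cells[OF y]
  obtain s where s: "s \<in> {..<r} \<rightarrow>\<^sub>E partitions" "cells r s = cells r x \<union> cells r y"
    using cells_union[OF x y] .
  obtain i where i: "i \<in> {..<r} \<rightarrow>\<^sub>E partitions" "cells r i = cells r x \<inter> cells r y"
    using cells_inter[OF x y] .
  have eq_cards: "card (cells r x) = card (cells r y)"
    using rank by (simp add: card_cells x y)
  have ne: "cells r x \<noteq> cells r y"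
    using cells_inject[OF x y] \<open>x \<noteq> y\<close> by blast
  have sum: "tuple_rank r s + tuple_rank r i = 2 * tuple_rank r x"
    using card_Un_Int[OF fin] rank by (simp add: s i x y flip: card_cells)
  have s_gt: "tuple_rank r x < tuple_rank r s"
  proof -
    have "cells r x \<subset> cells r s"
      using ne eq_cards fin s(2) by (metis Un_upper1 Un_upper2 card_subset_eq psubsetI)
    then show ?thesis
      using psubset_card_mono[OF finite_cells[OF s(1)]] by (metis card_cells s(1) x)
  qed
  have "z = s" if "z \<in> upper r x \<inter> upper r y" for z
  proof (rule cells_inject[OF _ s(1)])
    show z: "z \<in> {..<r} \<rightarrow>\<^sub>E partitions" using that by (simp add: upper_def)
    have "cells r s \<subseteq> cells r z" using that s by (simp add: upper_def)
    moreover have "card (cells r z) \<le> card (cells r s)"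
      using that s_gt card_cells[OF z] card_cells[OF s(1)] by (simp add: upper_def)
    ultimately show "cells r z = cells r s"
      using card_seteq[OF finite_cells[OF z]] by metis
  qed
  moreover have "s \<in> upper r x \<inter> upper r y \<longleftrightarrow> tuple_rank r s = Suc (tuple_rank r x)"
    using s rank by (auto simp: upper_def)
  ultimately have up: "upper r x \<inter> upper r y = (if tuple_rank r s = Suc (tuple_rank r x) then {s} else {})"
    by auto
  have "w = i" if "w \<in> lower r x \<inter> lower r y" for w
  proof (rule cells_inject[OF _ i(1)])
    show w: "w \<in> {..<r} \<rightarrow>\<^sub>E partitions" using that by (simp add: lower_def)
    have "cells r w \<subseteq> cells r i" using that i by (simp add: lower_def)
    moreover have "card (cells r i) \<le> card (cells r w)"
      using that s_gt sum card_cells[OF w] card_cells[OF i(1)] by (simp add: lower_def)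
    ultimately show "cells r w = cells r i"
      using card_seteq[OF finite_cells[OF i(1)]] by metis
  qed
  moreover have "i \<in> lower r x \<inter> lower r y \<longleftrightarrow> Suc (tuple_rank r i) = tuple_rank r x"
    using i rank by (auto simp: lower_def)
  ultimately have "lower r x \<inter> lower r y = (if Suc (tuple_rank r i) = tuple_rank r x then {i} else {})"
    by auto
  moreover have "Suc (tuple_rank r i) = tuple_rank r x \<longleftrightarrow> tuple_rank r s = Suc (tuple_rank r x)"
    using sum by auto
  ultimately show ?thesis using up by simp
qed

definition addable :: "(nat \<Rightarrow> nat) \<Rightarrow> nat set" where
  "addable p = {k. k = 0 \<or> p k < p (k - 1)}"

definition removable :: "(nat \<Rightarrow> nat) \<Rightarrow> nat set" where
  "removable p = {k. p (Suc k) < p k}"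

text \<open>
  A cell can be added in row \<open>k + 1\<close> exactly if one can be removed from row \<open>k\<close>, and a cell can always
  be added in the first row. This surplus of one per component is D2.
\<close>

lemma addable_eq: "addable p = insert 0 (Suc ` removable p)"
proof -
  have "k \<in> Suc ` removable p" if "p k < p (k - 1)" for k
    using that by (cases k) (auto simp: removable_def)
  then show ?thesis by (auto simp: addable_def removable_def)
qed

lemma finite_removable: "p \<in> partitions \<Longrightarrow> finite (removable p)"
  by (rule finite_subset[of _ "{i. p i \<noteq> 0}"]) (auto simp: partitions_def removable_def)

lemma card_addable: "p \<in> partitions \<Longrightarrow> card (addable p) = Suc (card (removable p))"
  by (simp add: addable_eq finite_removable card_image)

lemma update_partition_iff:
  assumes "p \<in> partitions"
  shows "p(k := Suc (p k)) \<in> partitions \<longleftrightarrow> k \<in> addable p"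
    and "0 < p k \<Longrightarrow> p(k := p k - 1) \<in> partitions \<longleftrightarrow> k \<in> removable p"
proof -
  have fin: "finite {i. (p(k := v)) i \<noteq> 0}" for v
    by (rule finite_subset[of _ "insert k {i. p i \<noteq> 0}"]) (use assms in \<open>auto simp: partitions_def\<close>)
  have dec: "p (Suc j) \<le> p j" for j
    using assms by (simp add: partitions_def antimono_nat_iff)
  have "antimono (p(k := Suc (p k))) \<longleftrightarrow> k \<in> addable p"
    unfolding antimono_nat_iff addable_def using dec
    by (cases k) (auto simp: Suc_le_eq le_Suc_eq less_Suc_eq_le)
  then show "p(k := Suc (p k)) \<in> partitions \<longleftrightarrow> k \<in> addable p"
    using fin by (simp add: partitions_def)
  have "antimono (p(k := p k - 1)) \<longleftrightarrow> k \<in> removable p" if "0 < p k"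
  proof
    assume "antimono (p(k := p k - 1))"
    then have "(p(k := p k - 1)) (Suc k) \<le> (p(k := p k - 1)) k"
      unfolding antimono_nat_iff by blast
    then show "k \<in> removable p" using that by (simp add: removable_def)
  next
    assume k: "k \<in> removable p"
    have "(p(k := p k - 1)) (Suc j) \<le> (p(k := p k - 1)) j" for j
      using dec[of j] k by (auto simp: removable_def)
    then show "antimono (p(k := p k - 1))" by (simp add: antimono_nat_iff)
  qed
  then show "0 < p k \<Longrightarrow> p(k := p k - 1) \<in> partitions \<longleftrightarrow> k \<in> removable p"
    using fin by (simp add: partitions_def)
qed

lemma ferrers_add_cell: "ferrers (p(k := Suc (p k))) = insert (k, p k) (ferrers p)"
  by (auto simp: ferrers_def split: if_splits)

lemma ferrers_remove_cell: "0 < p k \<Longrightarrow> ferrers (p(k := p k - 1)) = ferrers p - {(k, p k - 1)}"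
  by (auto simp: ferrers_def split: if_splits)

definition add_cell :: "(nat \<Rightarrow> nat \<Rightarrow> nat) \<Rightarrow> nat \<times> nat \<Rightarrow> nat \<Rightarrow> nat \<Rightarrow> nat" where
  "add_cell f = (\<lambda>(i, k). f(i := (f i)(k := Suc (f i k))))"

definition remove_cell :: "(nat \<Rightarrow> nat \<Rightarrow> nat) \<Rightarrow> nat \<times> nat \<Rightarrow> nat \<Rightarrow> nat \<Rightarrow> nat" where
  "remove_cell f = (\<lambda>(i, k). f(i := (f i)(k := f i k - 1)))"

lemma cells_add_cell: "i < r \<Longrightarrow> cells r (add_cell f (i, k)) = insert (i, k, f i k) (cells r f)"
  by (auto simp: cells_def add_cell_def ferrers_add_cell split: if_splits)

lemma cells_remove_cell:
  "i < r \<Longrightarrow> 0 < f i k \<Longrightarrow> cells r (remove_cell f (i, k)) = cells r f - {(i, k, f i k - 1)}"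
  by (auto simp: cells_def remove_cell_def ferrers_remove_cell simp del: One_nat_def split: if_splits)

lemma mem_cells: "(i, k, j) \<in> cells r f \<longleftrightarrow> i < r \<and> j < f i k"
  by (auto simp: cells_def ferrers_def)

lemma upper_eq:
  assumes f: "f \<in> {..<r} \<rightarrow>\<^sub>E partitions"
  shows "upper r f = add_cell f ` (SIGMA i:{..<r}. addable (f i))"
proof (intro equalityI subsetI)
  fix g assume g: "g \<in> upper r f"
  then have gP: "g \<in> {..<r} \<rightarrow>\<^sub>E partitions" and sub: "cells r f \<subseteq> cells r g"
    and card: "card (cells r g) = Suc (card (cells r f))"
    using card_cells[OF f] card_cells[of g r] by (auto simp: upper_def)
  have "card (cells r g - cells r f) = 1"
    using card sub finite_cells[OF f] by (simp add: card_Diff_subset)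
  then obtain i k j where c: "cells r g - cells r f = {(i, k, j)}"
    by (metis card_1_singletonE prod_cases3)
  have i: "i < r" "f i k \<le> j" "j < g i k"
    using c by (auto simp: mem_cells dest!: equalityD2)
  have "(i, k, f i k) \<in> cells r g - cells r f"
    using i by (auto simp: mem_cells)
  then have j: "j = f i k" using c by auto
  have g_eq: "cells r g = cells r (add_cell f (i, k))"
  proof -
    have "cells r g = insert (i, k, j) (cells r f)" using c sub by blast
    then show ?thesis using i j by (simp add: cells_add_cell)
  qed
  have "g = add_cell f (i, k)"
  proof
    fix i'
    show "g i' = add_cell f (i, k) i'"
    proof (cases "i' < r")
      case True
      then have "ferrers (g i') = ferrers (add_cell f (i, k) i')"
        using g_eq by (auto simp: cells_def)
      then show ?thesis by (rule ferrers_inject)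
    next
      case False
      then show ?thesis
        using PiE_arb[OF f, of i'] PiE_arb[OF gP, of i'] i(1) by (auto simp: add_cell_def)
    qed
  qed
  moreover from this have "g i = (f i)(k := Suc (f i k))"
    by (simp add: add_cell_def)
  then have "k \<in> addable (f i)"
    using update_partition_iff(1)[of "f i" k] PiE_mem[OF f, of i] PiE_mem[OF gP, of i] i by simp
  ultimately show "g \<in> add_cell f ` (SIGMA i:{..<r}. addable (f i))"
    using i(1) by (intro image_eqI[of _ _ "(i, k)"]) simp_all
next
  fix g assume "g \<in> add_cell f ` (SIGMA i:{..<r}. addable (f i))"
  then obtain i k where g: "g = add_cell f (i, k)" "i < r" "k \<in> addable (f i)" by auto
  have gP: "g \<in> {..<r} \<rightarrow>\<^sub>E partitions"
    using f g update_partition_iff(1)[of "f i" k]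
    by (auto simp: add_cell_def PiE_iff extensional_def)
  have "card (cells r g) = Suc (card (cells r f))"
    using g finite_cells[OF f] by (simp add: cells_add_cell mem_cells)
  then have "tuple_rank r g = Suc (tuple_rank r f)"
    by (simp only: card_cells[OF f] card_cells[OF gP])
  moreover have "cells r f \<subseteq> cells r g"
    unfolding g(1) cells_add_cell[OF g(2)] by blast
  ultimately show "g \<in> upper r f"
    using gP by (simp add: upper_def)
qed

lemma lower_eq:
  assumes f: "f \<in> {..<r} \<rightarrow>\<^sub>E partitions"
  shows "lower r f = remove_cell f ` (SIGMA i:{..<r}. removable (f i))"
proof (intro equalityI subsetI)
  fix g assume g: "g \<in> lower r f"
  then have gP: "g \<in> {..<r} \<rightarrow>\<^sub>E partitions" and sub: "cells r g \<subseteq> cells r f"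
    and card: "card (cells r f) = Suc (card (cells r g))"
    using card_cells[OF f] card_cells[of g r] by (auto simp: lower_def)
  have "card (cells r f - cells r g) = 1"
    using card sub finite_cells[OF gP] by (simp add: card_Diff_subset)
  then obtain i k j where c: "cells r f - cells r g = {(i, k, j)}"
    by (metis card_1_singletonE prod_cases3)
  have i: "i < r" "g i k \<le> j" "j < f i k"
    using c by (auto simp: mem_cells dest!: equalityD2)
  have "(i, k, f i k - 1) \<in> cells r f - cells r g"
    using i by (auto simp: mem_cells)
  then have j: "j = f i k - 1" using c by auto
  have g_eq: "cells r g = cells r (remove_cell f (i, k))"
  proof -
    have "cells r g = cells r f - {(i, k, j)}" using c sub by blast
    then show ?thesis using i j by (simp add: cells_remove_cell)
  qed
  have "g = remove_cell f (i, k)"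
  proof
    fix i'
    show "g i' = remove_cell f (i, k) i'"
    proof (cases "i' < r")
      case True
      then have "ferrers (g i') = ferrers (remove_cell f (i, k) i')"
        using g_eq by (auto simp: cells_def)
      then show ?thesis by (rule ferrers_inject)
    next
      case False
      then show ?thesis
        using PiE_arb[OF f, of i'] PiE_arb[OF gP, of i'] i(1) by (auto simp: remove_cell_def)
    qed
  qed
  moreover from this have "g i = (f i)(k := f i k - 1)"
    by (simp add: remove_cell_def)
  then have "k \<in> removable (f i)"
    using update_partition_iff(2)[of "f i" k] PiE_mem[OF f, of i] PiE_mem[OF gP, of i] i by simp
  ultimately show "g \<in> remove_cell f ` (SIGMA i:{..<r}. removable (f i))"
    using i(1) by (intro image_eqI[of _ _ "(i, k)"]) simp_all
next
  fix g assume "g \<in> remove_cell f ` (SIGMA i:{..<r}. removable (f i))"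
  then obtain i k where g: "g = remove_cell f (i, k)" "i < r" "k \<in> removable (f i)" by auto
  then have pos: "0 < f i k" by (auto simp: removable_def)
  have gP: "g \<in> {..<r} \<rightarrow>\<^sub>E partitions"
    using f g update_partition_iff(2)[of "f i" k] pos
    by (auto simp: remove_cell_def PiE_iff extensional_def)
  have "card (cells r f) = Suc (card (cells r g))"
    using g pos finite_cells[OF f] card_Suc_Diff1[of "cells r f" "(i, k, f i k - 1)"]
    by (simp add: cells_remove_cell mem_cells)
  then have "tuple_rank r f = Suc (tuple_rank r g)"
    by (simp only: card_cells[OF f] card_cells[OF gP])
  moreover have "cells r g \<subseteq> cells r f"
    unfolding g(1) cells_remove_cell[where f = f, OF g(2) pos] by blast
  ultimately show "g \<in> lower r f"
    using gP by (simp add: lower_def)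
qed

lemma
  assumes f: "f \<in> {..<r} \<rightarrow>\<^sub>E partitions"
  shows finite_upper: "finite (upper r f)"
    and card_upper: "card (upper r f) = card (lower r f) + r"
proof -
  have fin: "finite (removable (f i))" "finite (addable (f i))"
    and card: "card (addable (f i)) = Suc (card (removable (f i)))" if "i < r" for i
  proof -
    have "f i \<in> partitions" using f that by auto
    then show "finite (removable (f i))" "finite (addable (f i))"
      "card (addable (f i)) = Suc (card (removable (f i)))"
      by (simp_all add: finite_removable card_addable) (simp add: addable_eq finite_removable)
  qed
  show "finite (upper r f)"
    unfolding upper_eq[OF f] using fin by auto
  have "inj_on (add_cell f) (SIGMA i:{..<r}. addable (f i))"
  proof (rule inj_onI, clarify)
    fix i k i' k'
    assume "i < r" "i' < r" "add_cell f (i, k) = add_cell f (i', k')"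
    then have "insert (i, k, f i k) (cells r f) = insert (i', k', f i' k') (cells r f)"
      using cells_add_cell by metis
    then show "i = i' \<and> k = k'"
      using insert_ident[of "(i, k, f i k)" "cells r f" "cells r f"]
      by (metis insertE insertI1 less_irrefl mem_cells prod.inject)
  qed
  moreover have "inj_on (remove_cell f) (SIGMA i:{..<r}. removable (f i))"
  proof (rule inj_onI, clarify)
    fix i k i' k'
    assume *: "i < r" "i' < r" "k \<in> removable (f i)" "k' \<in> removable (f i')"
      "remove_cell f (i, k) = remove_cell f (i', k')"
    then have pos: "0 < f i k" "0 < f i' k'" by (auto simp: removable_def)
    then have "cells r f - {(i, k, f i k - 1)} = cells r f - {(i', k', f i' k' - 1)}"
      using * cells_remove_cell by metis
    moreover have "(i, k, f i k - 1) \<in> cells r f" using * pos by (simp add: mem_cells)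
    ultimately show "i = i' \<and> k = k'" by blast
  qed
  ultimately have "card (upper r f) = (\<Sum>i<r. card (addable (f i)))"
    "card (lower r f) = (\<Sum>i<r. card (removable (f i)))"
    unfolding upper_eq[OF f] lower_eq[OF f] using fin by (simp_all add: card_image)
  then show "card (upper r f) = card (lower r f) + r"
    by (simp add: card sum.distrib[of _ "\<lambda>_. 1", simplified] sum_Suc)
qed

theorem young_power_incidence:
  assumes "x \<in> {..<r} \<rightarrow>\<^sub>E partitions" "y \<in> {..<r} \<rightarrow>\<^sub>E partitions" "tuple_rank r x = tuple_rank r y"
  shows "card (upper r x \<inter> upper r y) = card (lower r x \<inter> lower r y) + (if x = y then r else 0)"
  using card_common_upper_eq_lower[OF assms(1,2) _ assms(3)] card_upper[OF assms(1)] by auto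

text \<open>
  The last nonzero row of a nonempty component has a removable cell.
\<close>

lemma lower_nonempty:
  assumes f: "f \<in> {..<r} \<rightarrow>\<^sub>E partitions" and "0 < tuple_rank r f"
  shows "lower r f \<noteq> {}"
proof -
  have "cells r f \<noteq> {}" using assms card_cells[OF f] by (metis card.empty less_irrefl)
  then obtain i k j where "(i, k, j) \<in> cells r f" by (metis ex_in_conv prod_cases3)
  then have i: "i < r" "f i k \<noteq> 0" by (simp_all add: mem_cells)
  then have p: "finite {k. f i k \<noteq> 0}" using f by (auto simp: PiE_iff partitions_def)
  let ?m = "Max {k. f i k \<noteq> 0}"
  have "?m \<in> {k. f i k \<noteq> 0}" using Max_in[OF p] i(2) by blast
  moreover have "f i (Suc ?m) = 0"
    using Max_ge[OF p, of "Suc ?m"] by auto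
  ultimately have "?m \<in> removable (f i)" by (simp add: removable_def)
  then show ?thesis unfolding lower_eq[OF f] using i(1) by blast
qed

lemma finite_rank_set_young_power: "finite (rank_set (young_power r) n)"
proof (induction n)
  case 0
  have "cells r f = {}" if "f \<in> rank_set (young_power r) 0" for f
    using that finite_cells[of f r] card_cells[of f r] by (auto simp: mem_rank_set_young_power)
  then have "f = g" if "f \<in> rank_set (young_power r) 0" "g \<in> rank_set (young_power r) 0" for f g
    using that cells_inject[of f r g] by (simp add: mem_rank_set_young_power)
  then have "\<exists>a. rank_set (young_power r) 0 \<subseteq> {a}" by blast
  then show ?case by (auto intro: finite_subset)
next
  case (Suc n)
  have "rank_set (young_power r) (Suc n) \<subseteq> (\<Union>f\<in>rank_set (young_power r) n. upper r f)"
  proof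
    fix g assume g: "g \<in> rank_set (young_power r) (Suc n)"
    then obtain f where "f \<in> lower r g"
      using lower_nonempty[of g r] by (auto simp: mem_rank_set_young_power)
    then have "f \<in> rank_set (young_power r) n" "g \<in> upper r f"
      using g by (auto simp: mem_rank_set_young_power lower_def upper_def)
    then show "g \<in> (\<Union>f\<in>rank_set (young_power r) n. upper r f)" by blast
  qed
  moreover have "finite (\<Union>f\<in>rank_set (young_power r) n. upper r f)"
    using Suc finite_upper by (auto simp: mem_rank_set_young_power)
  ultimately show ?case by (rule finite_subset)
qed

section \<open>Rank sizes of the powers\<close>

lemma mem_rank_set_young: "p \<in> rank_set young n \<longleftrightarrow> p \<in> partitions \<and> partition_size p = n"
  by (simp add: rank_set_def young_def)

lemma finite_rank_set_young: "finite (rank_set young n)"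
proof (rule finite_subset)
  show "rank_set young n \<subseteq> (\<lambda>f. f 0) ` rank_set (young_power 1) n"
  proof
    fix p assume "p \<in> rank_set young n"
    then have "(\<lambda>i\<in>{..<1}. p) \<in> rank_set (young_power 1) n"
      by (auto simp: mem_rank_set_young mem_rank_set_young_power)
    then show "p \<in> (\<lambda>f. f 0) ` rank_set (young_power 1) n"
      by (rule rev_image_eqI) simp
  qed
qed (simp add: finite_rank_set_young_power)

lemma rank_size_young_power_0: "rank_size (young_power 0) n = (if n = 0 then 1 else 0)"
  by (simp add: rank_size_def rank_set_def)

text \<open>
  Splitting off the last component of a tuple.
\<close>

lemma rank_size_young_power_Suc:
  "rank_size (young_power (Suc r)) n =
   (\<Sum>k\<le>n. rank_size young (n - k) * rank_size (young_power r) k)"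
proof -
  let ?glue = "\<lambda>(p, f). f(r := p) :: nat \<Rightarrow> nat \<Rightarrow> nat"
  let ?A = "\<lambda>k. rank_set young (n - k) \<times> rank_set (young_power r) k"
  have carrier: "{..<Suc r} \<rightarrow>\<^sub>E partitions = ?glue ` (partitions \<times> ({..<r} \<rightarrow>\<^sub>E partitions))"
    using PiE_insert_eq[of r "{..<r}" "\<lambda>_. partitions"] by (simp add: lessThan_Suc)
  have rank: "tuple_rank (Suc r) (f(r := p)) = tuple_rank r f + partition_size p" for f p
    by simp
  have eq: "rank_set (young_power (Suc r)) n = ?glue ` (\<Union>k\<le>n. ?A k)"
  proof (intro equalityI subsetI)
    fix g assume g: "g \<in> rank_set (young_power (Suc r)) n"
    then have "g \<in> ?glue ` (partitions \<times> ({..<r} \<rightarrow>\<^sub>E partitions))"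
      unfolding mem_rank_set_young_power carrier by blast
    then obtain p f where pf: "g = f(r := p)" "p \<in> partitions" "f \<in> {..<r} \<rightarrow>\<^sub>E partitions"
      by auto
    moreover have "tuple_rank r f + partition_size p = n"
      using g rank[of f p] by (simp only: mem_rank_set_young_power pf(1))
    ultimately have "(p, f) \<in> ?A (tuple_rank r f)" "tuple_rank r f \<le> n"
      by (auto simp: mem_rank_set_young mem_rank_set_young_power)
    then show "g \<in> ?glue ` (\<Union>k\<le>n. ?A k)"
      unfolding pf(1) by (intro image_eqI[of _ _ "(p, f)"]) auto
  next
    fix g assume "g \<in> ?glue ` (\<Union>k\<le>n. ?A k)"
    then obtain k p f where *: "g = f(r := p)" "k \<le> n" "p \<in> rank_set young (n - k)"
      "f \<in> rank_set (young_power r) k" by auto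
    then have "g \<in> {..<Suc r} \<rightarrow>\<^sub>E partitions"
      unfolding carrier mem_rank_set_young mem_rank_set_young_power by auto
    moreover have "tuple_rank (Suc r) g = n"
      unfolding *(1) rank using * by (simp add: mem_rank_set_young mem_rank_set_young_power)
    ultimately show "g \<in> rank_set (young_power (Suc r)) n"
      by (simp add: mem_rank_set_young_power)
  qed
  have "inj_on ?glue (\<Union>k\<le>n. ?A k)"
    by (rule inj_on_subset[OF inj_combinator[of r "{..<r}" "\<lambda>_. partitions"]])
      (auto simp: mem_rank_set_young mem_rank_set_young_power)
  then have "rank_size (young_power (Suc r)) n = card (\<Union>k\<le>n. ?A k)"
    unfolding rank_size_def eq by (rule card_image)
  also have "\<dots> = (\<Sum>k\<le>n. card (?A k))"
    using finite_rank_set_young finite_rank_set_young_power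
    by (intro card_UN_disjoint) (auto simp: mem_rank_set_young_power)
  finally show ?thesis by (simp add: rank_size_def card_cartesian_product)
qed

definition four_parts :: "nat \<times> nat \<times> nat \<times> nat \<Rightarrow> nat \<Rightarrow> nat" where
  "four_parts = (\<lambda>(a, b, c, d) k. if k = 0 then a else if k = 1 then b else if k = 2 then c
     else if k = 3 then d else 0)"

lemma inj_four_parts: "inj four_parts"
proof (rule injI)
  fix x y
  assume "four_parts x = four_parts y"
  from this[THEN fun_cong, of 0] this[THEN fun_cong, of 1] this[THEN fun_cong, of 2]
    this[THEN fun_cong, of 3]
  show "x = y" by (cases x; cases y) (simp add: four_parts_def)
qed

lemma partition_size_lessThan:
  assumes "\<And>k. N \<le> k \<Longrightarrow> p k = 0"
  shows "partition_size p = (\<Sum>k<N. p k)"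
proof -
  have "{i. p i \<noteq> 0} \<subseteq> {..<N}"
    using assms by (metis (mono_tags) lessThan_iff mem_Collect_eq not_le subsetI)
  then show ?thesis
    unfolding partition_size_def by (intro sum.mono_neutral_left) auto
qed

text \<open>
  Five nonzero parts would add up to at least \<open>5\<close>, so four parts describe the partition.
\<close>

lemma rank_set_young_small:
  assumes "n \<le> 4"
  shows "rank_set young n =
    four_parts ` {(a, b, c, d). d \<le> c \<and> c \<le> b \<and> b \<le> a \<and> a + b + c + d = n}"
proof (intro equalityI subsetI)
  fix p assume p: "p \<in> rank_set young n"
  then have fin: "finite {k. p k \<noteq> 0}" and dec: "antimono p" and size: "partition_size p = n"
    by (auto simp: mem_rank_set_young partitions_def)
  have "p 4 = 0"
  proof (rule ccontr)
    assume "p 4 \<noteq> 0"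
    then have nz: "p k \<noteq> 0" if "k \<in> {..<5}" for k
      using that antimonoD[OF dec, of k 4] by auto
    then have "(\<Sum>k<5::nat. 1) \<le> (\<Sum>k<5. p k)" by (intro sum_mono) (simp add: Suc_le_eq)
    also have "\<dots> \<le> partition_size p"
      unfolding partition_size_def using fin nz by (intro sum_mono2) auto
    finally show False using size assms by simp
  qed
  then have zero: "p k = 0" if "4 \<le> k" for k
    using antimonoD[OF dec that] by simp
  have "p = four_parts (p 0, p 1, p 2, p 3)"
  proof
    fix k :: nat
    consider "k = 0" | "k = 1" | "k = 2" | "k = 3" | "4 \<le> k" by linarith
    then show "p k = four_parts (p 0, p 1, p 2, p 3) k"
      by cases (use zero in \<open>auto simp: four_parts_def\<close>)
  qed
  moreover have "p 0 + p 1 + p 2 + p 3 = n"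
    using partition_size_lessThan[of 4 p] zero size by (simp add: numeral_eq_Suc)
  moreover have "p 3 \<le> p 2" "p 2 \<le> p 1" "p 1 \<le> p 0"
    by (auto intro!: antimonoD[OF dec])
  ultimately show "p \<in> four_parts ` {(a, b, c, d). d \<le> c \<and> c \<le> b \<and> b \<le> a \<and> a + b + c + d = n}"
    by (intro image_eqI[of _ _ "(p 0, p 1, p 2, p 3)"]) auto
next
  fix p assume "p \<in> four_parts ` {(a, b, c, d). d \<le> c \<and> c \<le> b \<and> b \<le> a \<and> a + b + c + d = n}"
  then obtain a b c d where p: "p = four_parts (a, b, c, d)" "d \<le> c" "c \<le> b" "b \<le> a" "a + b + c + d = n"
    by auto
  have "antimono p" using p by (auto simp: four_parts_def antimono_nat_iff)
  moreover have "{k. p k \<noteq> 0} \<subseteq> {..<4}" by (auto simp: p(1) four_parts_def split: if_splits)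
  then have "finite {k. p k \<noteq> 0}" by (rule finite_subset) simp
  moreover have "partition_size p = n"
    using partition_size_lessThan[of 4 p] p by (simp add: four_parts_def numeral_eq_Suc)
  ultimately show "p \<in> rank_set young n" by (simp add: mem_rank_set_young partitions_def)
qed

lemma rank_size_young_small:
  "rank_size young 0 = 1" "rank_size young 1 = 1" "rank_size young 2 = 2"
  "rank_size young 3 = 3" "rank_size young 4 = 5"
proof -
  let ?Q = "\<lambda>n. {(a, b, c, d). d \<le> c \<and> c \<le> b \<and> b \<le> a \<and> a + b + c + d = (n::nat)}"
  have size: "rank_size young n = card (?Q n)" if "n \<le> 4" for n
    unfolding rank_size_def rank_set_young_small[OF that]
    by (rule card_image) (rule inj_on_subset[OF inj_four_parts subset_UNIV])
  \<comment> \<open>A partition of at most \<open>4\<close> has third and fourth part at most \<open>1\<close> and second part at most \<open>2\<close>.\<close>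
  have count: "rank_size young n = (\<Sum>b<3. \<Sum>c<2. \<Sum>d<2.
      if d \<le> c \<and> c \<le> b \<and> b \<le> n - b - c - d \<and> b + c + d \<le> n then 1 else 0)" if "n \<le> 4" for n
  proof -
    let ?B = "{..<3} \<times> {..<2} \<times> {..<2::nat}"
    let ?P = "\<lambda>(b, c, d). d \<le> c \<and> c \<le> b \<and> b \<le> n - b - c - d \<and> b + c + d \<le> n"
    let ?first = "\<lambda>(b, c, d). (n - b - c - d, b, c, d)"
    have "?Q n = ?first ` {x \<in> ?B. ?P x}"
    proof (intro equalityI subsetI)
      fix q assume "q \<in> ?Q n"
      then obtain a b c d where q: "q = (a, b, c, d)" "d \<le> c" "c \<le> b" "b \<le> a" "a + b + c + d = n"
        by auto
      have "a = n - b - c - d" "d < 2" "c < 2" "b < 3"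
        using q that by linarith+
      with q show "q \<in> ?first ` {x \<in> ?B. ?P x}"
        by (intro image_eqI[of _ _ "(b, c, d)"]) simp_all
    qed auto
    moreover have "inj_on ?first {x \<in> ?B. ?P x}"
      by (auto simp: inj_on_def)
    ultimately have "card (?Q n) = card {x \<in> ?B. ?P x}"
      by (simp add: card_image)
    also have "\<dots> = (\<Sum>x\<in>?B. if ?P x then 1 else 0)"
      by (simp add: sum.inter_filter[symmetric])
    also have "\<dots> = (\<Sum>b<3. \<Sum>c<2. \<Sum>d<2.
      if d \<le> c \<and> c \<le> b \<and> b \<le> n - b - c - d \<and> b + c + d \<le> n then 1 else 0)"
      unfolding sum.cartesian_product by (intro sum.cong) (auto split: if_splits)
    finally show ?thesis using size[OF that] by (simp only:)
  qed
  show "rank_size young 0 = 1" "rank_size young 1 = 1" "rank_size young 2 = 2"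
    "rank_size young 3 = 3" "rank_size young 4 = 5"
    by (simp_all add: count lessThan_Suc lessThan_nat_numeral)
qed

text \<open>
  The recursion over \<open>r\<close> with the partition numbers \<open>1, 1, 2, 3, 5\<close> makes each rank size a polynomial
  in \<open>r\<close>; the equations are cleared of denominators to stay within the natural numbers.
\<close>

lemma rank_size_young_power_small:
  shows "rank_size (young_power r) 0 = 1"
    and "rank_size (young_power r) 1 = r"
    and "2 * rank_size (young_power r) 2 = r * (r + 3)"
    and "6 * rank_size (young_power r) 3 = r * (r + 1) * (r + 8)"
    and "24 * rank_size (young_power r) 4 = r * (r + 1) * (r\<^sup>2 + 17 * r + 42)"
proof (induction r)
  case 0
  { case 1 show ?case by (simp add: rank_size_young_power_0)
  next case 2 show ?case by (simp add: rank_size_young_power_0)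
  next case 3 show ?case by (simp add: rank_size_young_power_0)
  next case 4 show ?case by (simp add: rank_size_young_power_0)
  next case 5 show ?case by (simp add: rank_size_young_power_0)
  }
next
  case (Suc r)
  have rec: "rank_size (young_power (Suc r)) 0 = rank_size (young_power r) 0"
    "rank_size (young_power (Suc r)) 1 = rank_size (young_power r) 0 + rank_size (young_power r) 1"
    "rank_size (young_power (Suc r)) 2 = 2 * rank_size (young_power r) 0 +
      rank_size (young_power r) 1 + rank_size (young_power r) 2"
    "rank_size (young_power (Suc r)) 3 = 3 * rank_size (young_power r) 0 +
      2 * rank_size (young_power r) 1 + rank_size (young_power r) 2 + rank_size (young_power r) 3"
    "rank_size (young_power (Suc r)) 4 = 5 * rank_size (young_power r) 0 +
      3 * rank_size (young_power r) 1 + 2 * rank_size (young_power r) 2 +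
      rank_size (young_power r) 3 + rank_size (young_power r) 4"
    using rank_size_young_small
    by (simp_all add: rank_size_young_power_Suc numeral_eq_Suc)
  { case 1 show ?case using Suc rec by simp
  next case 2 show ?case using Suc rec by simp
  next case 3 show ?case using Suc rec by (simp add: algebra_simps)
  next case 4 show ?case using Suc rec by (simp add: algebra_simps)
  next case 5 show ?case using Suc rec by (simp add: algebra_simps power2_eq_square)
  }
qed

section \<open>Powers of Young's lattice as towers\<close>

text \<open>
  Towers know elements by their positions only; this translates blocks accordingly.
\<close>

definition index_set :: "'a list \<Rightarrow> 'a set \<Rightarrow> nat set" where
  "index_set xs B = {k. k < length xs \<and> xs ! k \<in> B}"

lemma index_set_Int: "index_set xs B \<inter> index_set xs C = index_set xs (B \<inter> C)"
  by (auto simp: index_set_def)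

lemma card_index_set:
  assumes "distinct xs" "B \<subseteq> set xs"
  shows "card (index_set xs B) = card B"
proof -
  have "(!) xs ` index_set xs B = B"
    using assms(2) by (force simp: index_set_def in_set_conv_nth)
  moreover have "inj_on ((!) xs) (index_set xs B)"
    using assms(1) by (auto simp: inj_on_def index_set_def nth_eq_iff_index_eq)
  ultimately show ?thesis by (metis card_image)
qed

lemma length_filter_distinct: "distinct xs \<Longrightarrow> length (filter P xs) = card {x \<in> set xs. P x}"
  by (metis distinct_card distinct_filter set_filter)

definition rank_list :: "nat \<Rightarrow> nat \<Rightarrow> (nat \<Rightarrow> nat \<Rightarrow> nat) list" where
  "rank_list r n = (SOME xs. set xs = rank_set (young_power r) n \<and> distinct xs)"

lemma set_rank_list [simp]: "set (rank_list r n) = rank_set (young_power r) n"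
  and distinct_rank_list [simp]: "distinct (rank_list r n)"
  using someI_ex[OF finite_distinct_list[OF finite_rank_set_young_power[of r n]]]
  by (auto simp: rank_list_def)

lemma length_rank_list: "length (rank_list r n) = rank_size (young_power r) n"
  by (metis distinct_card distinct_rank_list rank_size_def set_rank_list)

definition young_tower :: "nat \<Rightarrow> nat \<Rightarrow> nat set list" where
  "young_tower r n = map (\<lambda>x. index_set (rank_list r (n - 1)) (lower r x)) (rank_list r n)"

lemma length_young_tower: "length (young_tower r n) = rank_size (young_power r) n"
  by (simp add: young_tower_def length_rank_list)

lemma lower_subset_rank_set:
  "x \<in> rank_set (young_power r) n \<Longrightarrow> lower r x \<subseteq> rank_set (young_power r) (n - 1)"
  by (auto simp: lower_def mem_rank_set_young_power)

lemma young_tower_0: "young_tower r 0 = [{}]"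
proof -
  have "lower r x = {}" if "x \<in> rank_set (young_power r) 0" for x
    using that by (auto simp: lower_def mem_rank_set_young_power)
  then have "young_tower r 0 = map (\<lambda>_. {}) (rank_list r 0)"
    by (auto simp: young_tower_def index_set_def)
  moreover have "length (rank_list r 0) = 1"
    by (simp add: length_rank_list rank_size_young_power_small)
  ultimately show ?thesis by (auto simp: length_Suc_conv)
qed

text \<open>
  Any family of blocks on the rank-\<open>n\<close> tuples with the right pair and point counts may serve as the
  next level above the levels of \<open>Y\<^sup>r\<close> up to \<open>n\<close>. It is used for the true next level of \<open>Y\<^sup>r\<close> and for
  the modified rank \<open>4\<close>.
\<close>

lemma incidence_step_young_tower:
  assumes sub: "\<And>B. B \<in> set Bs \<Longrightarrow> B \<noteq> {} \<and> B \<subseteq> rank_set (young_power r) n"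
    and count: "\<And>x y. x \<in> rank_set (young_power r) n \<Longrightarrow> y \<in> rank_set (young_power r) n \<Longrightarrow>
      length (filter (\<lambda>B. x \<in> B \<and> y \<in> B) Bs) =
      card (lower r x \<inter> lower r y) + (if x = y then r else 0)"
  shows "incidence_step r (young_tower r n) (map (index_set (rank_list r n)) Bs)"
  unfolding incidence_step_def
proof (intro conjI ballI allI impI)
  fix S assume "S \<in> set (map (index_set (rank_list r n)) Bs)"
  then obtain B where B: "B \<in> set Bs" "S = index_set (rank_list r n) B" by auto
  from sub[OF B(1)] have "card S = card B" "B \<noteq> {}" "finite B"
    unfolding B(2) using finite_rank_set_young_power finite_subset
    by (auto simp: card_index_set)
  then show "S \<noteq> {}" by auto
  show "S \<subseteq> {..<length (young_tower r n)}"
    by (auto simp: B(2) index_set_def young_tower_def)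
next
  fix k l assume kl: "k < length (young_tower r n)" "l < length (young_tower r n)"
  let ?x = "rank_list r n ! k" and ?y = "rank_list r n ! l"
  have len: "k < length (rank_list r n)" "l < length (rank_list r n)"
    using kl by (simp_all add: young_tower_def)
  then have mem: "?x \<in> rank_set (young_power r) n" "?y \<in> rank_set (young_power r) n"
    using nth_mem set_rank_list by blast+
  have "length (filter (\<lambda>S. k \<in> S \<and> l \<in> S) (map (index_set (rank_list r n)) Bs)) =
      length (filter (\<lambda>B. ?x \<in> B \<and> ?y \<in> B) Bs)"
    using len by (simp add: filter_map comp_def index_set_def)
  also have "\<dots> = card (lower r ?x \<inter> lower r ?y) + (if ?x = ?y then r else 0)"
    by (rule count[OF mem])
  also have "card (lower r ?x \<inter> lower r ?y) = card (young_tower r n ! k \<inter> young_tower r n ! l)"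
    using len lower_subset_rank_set[OF mem(1)]
    by (auto simp: young_tower_def index_set_Int intro!: card_index_set[symmetric])
  also have "(?x = ?y) = (k = l)"
    using len by (simp add: nth_eq_iff_index_eq)
  finally show "length (filter (\<lambda>S. k \<in> S \<and> l \<in> S) (map (index_set (rank_list r n)) Bs)) =
      card (young_tower r n ! k \<inter> young_tower r n ! l) + (if k = l then r else 0)" .
qed

lemma upper_iff_lower:
  assumes "x \<in> rank_set (young_power r) n"
  shows "z \<in> upper r x \<longleftrightarrow> z \<in> rank_set (young_power r) (Suc n) \<and> x \<in> lower r z"
  using assms unfolding upper_def lower_def mem_rank_set_young_power mem_Collect_eq by metis

lemma young_blocks_count:
  assumes zs: "distinct zs" "set zs = rank_set (young_power r) (Suc n)"
    and x: "x \<in> rank_set (young_power r) n" and y: "y \<in> rank_set (young_power r) n"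
  shows "length (filter (\<lambda>B. x \<in> B \<and> y \<in> B) (map (lower r) zs)) =
      card (lower r x \<inter> lower r y) + (if x = y then r else 0)"
proof -
  have "{z \<in> set zs. x \<in> lower r z \<and> y \<in> lower r z} = upper r x \<inter> upper r y"
    unfolding zs(2) using upper_iff_lower[OF x] upper_iff_lower[OF y] by blast
  then have "length (filter (\<lambda>B. x \<in> B \<and> y \<in> B) (map (lower r) zs)) = card (upper r x \<inter> upper r y)"
    using length_filter_distinct[OF zs(1)] by (simp add: filter_map comp_def)
  also have "\<dots> = card (lower r x \<inter> lower r y) + (if x = y then r else 0)"
    using x y by (intro young_power_incidence) (simp_all add: mem_rank_set_young_power)
  finally show ?thesis .
qed

lemma young_block:
  assumes "z \<in> rank_set (young_power r) (Suc n)"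
  shows "lower r z \<noteq> {} \<and> lower r z \<subseteq> rank_set (young_power r) n"
  using lower_nonempty[of z r] lower_subset_rank_set[OF assms] assms
  by (simp add: mem_rank_set_young_power)

lemma incidence_step_young: "incidence_step r (young_tower r n) (young_tower r (Suc n))"
proof -
  have "young_tower r (Suc n) = map (index_set (rank_list r n)) (map (lower r) (rank_list r (Suc n)))"
    by (simp add: young_tower_def)
  moreover have "incidence_step r (young_tower r n)
      (map (index_set (rank_list r n)) (map (lower r) (rank_list r (Suc n))))"
  proof (rule incidence_step_young_tower)
    show "B \<noteq> {} \<and> B \<subseteq> rank_set (young_power r) n" if "B \<in> set (map (lower r) (rank_list r (Suc n)))" for B
      using that young_block[of _ r n] by auto
  qed (rule young_blocks_count, simp_all)
  ultimately show ?thesis by simp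
qed

section \<open>Exchanging covers on three components\<close>

text \<open>
  Only partitions with at most two rows take part in the exchange; a shape lists the two row lengths.
  The \<open>t\<close>-th exchange takes place in the components \<open>3 t\<close>, \<open>3 t + 1\<close>, \<open>3 t + 2\<close>, all other components
  being empty.
\<close>

type_synonym shape = "nat \<times> nat"
type_synonym shapes = "shape \<times> shape \<times> shape"

definition two_rows :: "shape \<Rightarrow> nat \<Rightarrow> nat" where
  "two_rows = (\<lambda>(u, v) k. if k = 0 then u else if k = 1 then v else 0)"

definition shapes_tuple :: "nat \<Rightarrow> nat \<Rightarrow> shapes \<Rightarrow> nat \<Rightarrow> nat \<Rightarrow> nat" where
  "shapes_tuple r t = (\<lambda>(p, q, s). \<lambda>i\<in>{..<r}. two_rows
     (if i = 3 * t then p else if i = 3 * t + 1 then q else if i = 3 * t + 2 then s else (0, 0)))"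

definition shape_lower :: "shape \<Rightarrow> shape list" where
  "shape_lower = (\<lambda>(u, v). (if v < u then [(u - 1, v)] else []) @ (if 0 < v then [(u, v - 1)] else []))"

definition shapes_lower :: "shapes \<Rightarrow> shapes list" where
  "shapes_lower = (\<lambda>(p, q, s). map (\<lambda>p'. (p', q, s)) (shape_lower p) @
     map (\<lambda>q'. (p, q', s)) (shape_lower q) @ map (\<lambda>s'. (p, q, s')) (shape_lower s))"

text \<open>
  The thirteen rank-4 elements given up. The first three have a single lower cover \<open>21\<close>, the
  next six have three lower covers, the last four have two.
\<close>

definition removed_elements :: "shapes list" where
  "removed_elements =
    [((2, 2), (0, 0), (0, 0)), ((0, 0), (2, 2), (0, 0)), ((0, 0), (0, 0), (2, 2)),
     ((2, 1), (1, 0), (0, 0)), ((2, 1), (0, 0), (1, 0)),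
     ((1, 0), (2, 1), (0, 0)), ((1, 0), (0, 0), (2, 1)),
     ((2, 0), (1, 0), (1, 0)), ((1, 1), (1, 0), (1, 0)),
     ((1, 1), (2, 0), (0, 0)), ((1, 1), (1, 1), (0, 0)),
     ((1, 1), (0, 0), (2, 0)), ((1, 1), (0, 0), (1, 1))]"

text \<open>
  The lower covers of the twelve replacements: five triples and seven pairs. Altogether one triple
  has become three pairs. With the pair counts kept, this puts the element \<open>21\<close> of each component in
  one block more, which makes up for the loss of its upper cover \<open>22\<close>.
\<close>

definition added_blocks :: "shapes list list" where
  "added_blocks =
    [[((1, 0), (1, 0), (1, 0)), ((2, 0), (1, 0), (0, 0)), ((1, 1), (1, 0), (0, 0))],
     [((1, 0), (1, 0), (1, 0)), ((2, 0), (0, 0), (1, 0)), ((1, 1), (0, 0), (1, 0))],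
     [((2, 1), (0, 0), (0, 0)), ((2, 0), (1, 0), (0, 0)), ((2, 0), (0, 0), (1, 0))],
     [((1, 1), (1, 0), (0, 0)), ((1, 0), (2, 0), (0, 0)), ((1, 0), (1, 1), (0, 0))],
     [((1, 1), (0, 0), (1, 0)), ((1, 0), (0, 0), (2, 0)), ((1, 0), (0, 0), (1, 1))],
     [((2, 1), (0, 0), (0, 0)), ((1, 1), (1, 0), (0, 0))],
     [((2, 1), (0, 0), (0, 0)), ((1, 1), (0, 0), (1, 0))],
     [((0, 0), (2, 1), (0, 0)), ((1, 0), (2, 0), (0, 0))],
     [((0, 0), (2, 1), (0, 0)), ((1, 0), (1, 1), (0, 0))],
     [((0, 0), (0, 0), (2, 1)), ((1, 0), (0, 0), (2, 0))],
     [((0, 0), (0, 0), (2, 1)), ((1, 0), (0, 0), (1, 1))],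
     [((1, 1), (1, 0), (0, 0)), ((1, 1), (0, 0), (1, 0))]]"

text \<open>
  Expanded, both sides are the sum of \<open>X u * Y v\<close> over the pairs \<open>u, v\<close> that lie in a common block: as
  \<open>X\<close> and \<open>Y\<close> are arbitrary, removed and added blocks contain every pair, and (for \<open>u = v\<close>) every
  point, equally often.
\<close>

lemma swap_identity:
  fixes X Y :: "shapes \<Rightarrow> nat"
  shows "(\<Sum>z\<leftarrow>removed_elements. (\<Sum>u\<leftarrow>shapes_lower z. X u) * (\<Sum>u\<leftarrow>shapes_lower z. Y u)) =
    (\<Sum>B\<leftarrow>added_blocks. (\<Sum>u\<leftarrow>B. X u) * (\<Sum>u\<leftarrow>B. Y u))"
  by (simp add: removed_elements_def added_blocks_def shapes_lower_def shape_lower_def algebra_simps)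

lemma two_rows_partition:
  "v \<le> u \<Longrightarrow> two_rows (u, v) \<in> partitions" "partition_size (two_rows (u, v)) = u + v"
proof -
  have "{k. two_rows (u, v) k \<noteq> 0} \<subseteq> {..<2}"
    by (auto simp: two_rows_def split: if_splits)
  then have "finite {k. two_rows (u, v) k \<noteq> 0}" by (rule finite_subset) simp
  then show "v \<le> u \<Longrightarrow> two_rows (u, v) \<in> partitions"
    by (auto simp: partitions_def antimono_nat_iff two_rows_def)
  show "partition_size (two_rows (u, v)) = u + v"
    using partition_size_lessThan[of 2 "two_rows (u, v)"] by (simp add: two_rows_def numeral_2_eq_2)
qed

definition valid_shapes :: "shapes \<Rightarrow> bool" where
  "valid_shapes = (\<lambda>((a, a'), (b, b'), (c, c')). a' \<le> a \<and> b' \<le> b \<and> c' \<le> c)"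

definition shapes_size :: "shapes \<Rightarrow> nat" where
  "shapes_size = (\<lambda>((a, a'), (b, b'), (c, c')). a + a' + b + b' + c + c')"

lemma shapes_tuple_mem_rank_set:
  assumes "3 * t + 2 < r" "valid_shapes x"
  shows "shapes_tuple r t x \<in> rank_set (young_power r) (shapes_size x)"
proof -
  obtain a a' b b' c c' where x: "x = ((a, a'), (b, b'), (c, c'))" by (metis prod.exhaust)
  let ?s = "\<lambda>i. if i = 3 * t then (a, a') else if i = 3 * t + 1 then (b, b')
     else if i = 3 * t + 2 then (c, c') else (0, 0)"
  have carrier: "shapes_tuple r t x \<in> {..<r} \<rightarrow>\<^sub>E partitions"
    using assms(2) by (auto simp: x shapes_tuple_def valid_shapes_def intro!: two_rows_partition)
  have "tuple_rank r (shapes_tuple r t x) = (\<Sum>i<r. partition_size (two_rows (?s i)))"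
    by (simp add: x shapes_tuple_def)
  also have "\<dots> = (\<Sum>i\<in>{3 * t, 3 * t + 1, 3 * t + 2}. partition_size (two_rows (?s i)))"
    using assms(1) by (intro sum.mono_neutral_right) (auto simp: two_rows_partition)
  also have "\<dots> = shapes_size x"
    by (simp add: x shapes_size_def two_rows_partition)
  finally show ?thesis using carrier by (simp add: mem_rank_set_young_power)
qed

lemma inj_shapes_tuple:
  assumes "3 * t + 2 < r"
  shows "inj (shapes_tuple r t)"
proof (rule injI)
  fix x y assume eq: "shapes_tuple r t x = shapes_tuple r t y"
  have "shapes_tuple r t x i k = shapes_tuple r t y i k" for i k using eq by simp
  from this[of "3 * t" 0] this[of "3 * t" 1] this[of "3 * t + 1" 0] this[of "3 * t + 1" 1]
    this[of "3 * t + 2" 0] this[of "3 * t + 2" 1] assms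
  show "x = y"
    by (cases x; cases y) (auto simp: shapes_tuple_def two_rows_def split: prod.splits)
qed

lemma removable_two_rows:
  "removable (two_rows (u, v)) = (if v < u then {0} else {}) \<union> (if 0 < v then {1} else {})"
  by (auto simp: removable_def two_rows_def split: if_splits)

text \<open>
  Only the three distinguished components have removable cells, and removing one there is
  \<^const>\<open>shapes_lower\<close>.
\<close>

lemma lower_shapes_tuple:
  assumes t: "3 * t + 2 < r" and "valid_shapes x"
  shows "lower r (shapes_tuple r t x) = shapes_tuple r t ` set (shapes_lower x)"
proof -
  obtain a a' b b' c c' where x: "x = ((a, a'), (b, b'), (c, c'))" by (metis prod.exhaust)
  let ?f = "shapes_tuple r t x"
  have f: "?f \<in> {..<r} \<rightarrow>\<^sub>E partitions"
    using shapes_tuple_mem_rank_set[OF assms] by (simp add: mem_rank_set_young_power)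
  have at: "?f (3 * t) = two_rows (a, a')" "?f (Suc (3 * t)) = two_rows (b, b')"
    "?f (Suc (Suc (3 * t))) = two_rows (c, c')"
    using t by (simp_all add: x shapes_tuple_def)
  have other: "removable (?f i) = {}" if "i < r" "i \<notin> {3 * t, Suc (3 * t), Suc (Suc (3 * t))}" for i
  proof -
    have "?f i = two_rows (0, 0)" using that by (auto simp: x shapes_tuple_def)
    then show ?thesis by (simp add: removable_two_rows)
  qed
  have "(SIGMA i:{..<r}. removable (?f i)) =
    {3 * t} \<times> removable (two_rows (a, a')) \<union> {Suc (3 * t)} \<times> removable (two_rows (b, b')) \<union>
    {Suc (Suc (3 * t))} \<times> removable (two_rows (c, c'))"
    (is "_ = ?R")
  proof (intro equalityI subrelI)
    fix i k assume "(i, k) \<in> (SIGMA i:{..<r}. removable (?f i))"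
    then have i: "i < r" "k \<in> removable (?f i)" by auto
    then have "i \<in> {3 * t, Suc (3 * t), Suc (Suc (3 * t))}" using other by blast
    with i(2) show "(i, k) \<in> ?R" using at by auto
  next
    fix i k assume "(i, k) \<in> ?R"
    then show "(i, k) \<in> (SIGMA i:{..<r}. removable (?f i))" using t at by auto
  qed
  then have "lower r ?f = remove_cell ?f ` ?R"
    by (simp only: lower_eq[OF f])
  also have "\<dots> = shapes_tuple r t ` set (shapes_lower x)"
  proof -
    have "remove_cell ?f (3 * t, 0) = shapes_tuple r t ((a - 1, a'), (b, b'), (c, c'))"
      "remove_cell ?f (3 * t, 1) = shapes_tuple r t ((a, a' - 1), (b, b'), (c, c'))"
      "remove_cell ?f (Suc (3 * t), 0) = shapes_tuple r t ((a, a'), (b - 1, b'), (c, c'))"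
      "remove_cell ?f (Suc (3 * t), 1) = shapes_tuple r t ((a, a'), (b, b' - 1), (c, c'))"
      "remove_cell ?f (Suc (Suc (3 * t)), 0) = shapes_tuple r t ((a, a'), (b, b'), (c - 1, c'))"
      "remove_cell ?f (Suc (Suc (3 * t)), 1) = shapes_tuple r t ((a, a'), (b, b'), (c, c' - 1))"
      using t by (auto simp: x remove_cell_def shapes_tuple_def two_rows_def fun_eq_iff)
    then have
      "remove_cell ?f ` ({3 * t} \<times> removable (two_rows (a, a'))) =
        (\<lambda>p. shapes_tuple r t (p, (b, b'), (c, c'))) ` set (shape_lower (a, a'))"
      "remove_cell ?f ` ({Suc (3 * t)} \<times> removable (two_rows (b, b'))) =
        (\<lambda>p. shapes_tuple r t ((a, a'), p, (c, c'))) ` set (shape_lower (b, b'))"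
      "remove_cell ?f ` ({Suc (Suc (3 * t))} \<times> removable (two_rows (c, c'))) =
        (\<lambda>p. shapes_tuple r t ((a, a'), (b, b'), p)) ` set (shape_lower (c, c'))"
      unfolding removable_two_rows shape_lower_def
      by (simp_all del: One_nat_def add: image_Un Sigma_Un_distrib2)
    then show ?thesis
      by (simp only: image_Un) (simp add: x shapes_lower_def image_Un image_image Un_assoc)
  qed
  finally show ?thesis .
qed

section \<open>Rank four with fewer elements\<close>

lemma length_filter_common: 
  "length (filter (\<lambda>B. x \<in> B \<and> y \<in> B) Bs) =
   (\<Sum>B\<leftarrow>Bs. of_bool (x \<in> B) * of_bool (y \<in> B))"
  by (induction Bs) auto

lemma of_bool_mem_image:
  assumes "inj f" "distinct us"
  shows "of_bool (x \<in> f ` set us) = (\<Sum>u\<leftarrow>us. of_bool (x = f u) :: nat)"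
  using assms(2)
proof (induction us)
  case (Cons u us)
  then have "x = f u \<Longrightarrow> x \<notin> f ` set us"
    using assms(1) by (auto dest: injD)
  with Cons show ?case by auto
qed simp

lemma removed_elements_valid:
  "z \<in> set removed_elements \<Longrightarrow> valid_shapes z \<and> shapes_size z = 4 \<and> distinct (shapes_lower z)"
  by (auto simp: removed_elements_def valid_shapes_def shapes_size_def shapes_lower_def shape_lower_def)

lemma added_blocks_valid:
  "B \<in> set added_blocks \<Longrightarrow> B \<noteq> [] \<and> distinct B \<and> (\<forall>u\<in>set B. valid_shapes u \<and> shapes_size u = 3)"
  by (auto simp: added_blocks_def valid_shapes_def shapes_size_def)

text \<open>
  The identity of formal weights, specialised to the indicator functions of \<open>x\<close> and \<open>y\<close>. A block has
  distinct entries, so the weights of its entries add up to its own indicator.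
\<close>

lemma swap_preserves_counts:
  assumes t: "3 * t + 2 < r"
  shows "length (filter (\<lambda>B. x \<in> B \<and> y \<in> B) (map (\<lambda>z. lower r (shapes_tuple r t z)) removed_elements)) =
    length (filter (\<lambda>B. x \<in> B \<and> y \<in> B) (map (\<lambda>B. shapes_tuple r t ` set B) added_blocks))"
proof -
  let ?X = "\<lambda>u. of_bool (x = shapes_tuple r t u) :: nat" and ?Y = "\<lambda>u. of_bool (y = shapes_tuple r t u) :: nat"
  note mem = of_bool_mem_image[OF inj_shapes_tuple[OF t]]
  have "(\<Sum>z\<leftarrow>removed_elements. of_bool (x \<in> lower r (shapes_tuple r t z)) * of_bool (y \<in> lower r (shapes_tuple r t z))) =
      (\<Sum>z\<leftarrow>removed_elements. (\<Sum>u\<leftarrow>shapes_lower z. ?X u) * (\<Sum>u\<leftarrow>shapes_lower z. ?Y u))"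
    using removed_elements_valid
    by (intro arg_cong[where f = sum_list] map_cong refl) (simp add: lower_shapes_tuple[OF t] mem)
  also have "\<dots> = (\<Sum>B\<leftarrow>added_blocks. (\<Sum>u\<leftarrow>B. ?X u) * (\<Sum>u\<leftarrow>B. ?Y u))"
    by (rule swap_identity)
  also have "\<dots> = (\<Sum>B\<leftarrow>added_blocks. of_bool (x \<in> shapes_tuple r t ` set B) * of_bool (y \<in> shapes_tuple r t ` set B))"
    using added_blocks_valid
    by (intro arg_cong[where f = sum_list] map_cong refl) (simp add: mem)
  finally show ?thesis
    by (simp add: length_filter_common comp_def)
qed

definition removed_list :: "nat \<Rightarrow> (nat \<Rightarrow> nat \<Rightarrow> nat) list" where
  "removed_list r = concat (map (\<lambda>t. map (shapes_tuple r t) removed_elements) [0..<r div 3])"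

definition added_list :: "nat \<Rightarrow> (nat \<Rightarrow> nat \<Rightarrow> nat) set list" where
  "added_list r = concat (map (\<lambda>t. map (\<lambda>B. shapes_tuple r t ` set B) added_blocks) [0..<r div 3])"

lemma length_removed_list: "length (removed_list r) = 13 * (r div 3)"
  and length_added_list: "length (added_list r) = 12 * (r div 3)"
  by (simp_all add: removed_list_def added_list_def length_concat comp_def sum_list_triv
      removed_elements_def added_blocks_def)

text \<open>
  Nonempty tuples from different exchanges have disjoint supports, so the exchanges do not
  interfere.
\<close>

lemma shapes_tuple_disjoint:
  assumes "3 * t + 2 < r" "3 * t' + 2 < r" "shapes_tuple r t z = shapes_tuple r t' z'" "0 < shapes_size z"
  shows "t = t'"
proof (rule ccontr)
  assume "t \<noteq> t'"
  obtain a a' b b' c c' where z: "z = ((a, a'), (b, b'), (c, c'))" by (metis prod.exhaust)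
  have zero: "shapes_tuple r t' z' (3 * t + j) k = 0" if "j < 3" for j k
  proof -
    have "3 * t + j \<noteq> 3 * t'" "3 * t + j \<noteq> 3 * t' + 1" "3 * t + j \<noteq> 3 * t' + 2"
      using that \<open>t \<noteq> t'\<close> by presburger+
    then show ?thesis
      using that assms(1) by (cases z') (simp add: shapes_tuple_def two_rows_def)
  qed
  have "shapes_tuple r t z (3 * t + j) k = 0" if "j < 3" for j k
    using zero[OF that] assms(3) by simp
  from this[of 0 0] this[of 0 1] this[of 1 0] this[of 1 1] this[of 2 0] this[of 2 1]
  have "shapes_size z = 0"
    using assms(1) by (simp add: z shapes_tuple_def two_rows_def shapes_size_def)
  with assms(4) show False by simp
qed

lemma block_of_three: "t < r div 3 \<Longrightarrow> 3 * t + 2 < (r::nat)"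
  by linarith

lemma distinct_removed_list: "distinct (removed_list r)"
proof -
  have "removed_list r = map (\<lambda>(t, z). shapes_tuple r t z) (List.product [0..<r div 3] removed_elements)"
    by (simp add: removed_list_def product_concat_map map_concat comp_def)
  moreover have "inj_on (\<lambda>(t, z). shapes_tuple r t z) ({0..<r div 3} \<times> set removed_elements)"
  proof (rule inj_onI, clarify)
    fix t z t' z'
    assume *: "t \<in> {0..<r div 3}" "t' \<in> {0..<r div 3}" "z \<in> set removed_elements"
      "shapes_tuple r t z = shapes_tuple r t' z'"
    then have t: "3 * t + 2 < r" "3 * t' + 2 < r" by (auto intro: block_of_three)
    have "t = t'"
      using shapes_tuple_disjoint[OF t *(4)] removed_elements_valid[OF *(3)] by simp
    moreover from this have "z = z'" using *(4) inj_shapes_tuple[OF t(1)] by (simp add: inj_eq)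
    ultimately show "t = t' \<and> z = z'" by simp
  qed
  moreover have "distinct removed_elements"
    by (simp add: removed_elements_def)
  ultimately show ?thesis by (simp add: distinct_map distinct_product)
qed

lemma removed_list_subset: "set (removed_list r) \<subseteq> rank_set (young_power r) 4"
  using shapes_tuple_mem_rank_set[OF block_of_three] removed_elements_valid
  by (fastforce simp: removed_list_def)

definition swapped_blocks :: "nat \<Rightarrow> (nat \<Rightarrow> nat \<Rightarrow> nat) set list" where
  "swapped_blocks r = map (lower r) (filter (\<lambda>z. z \<notin> set (removed_list r)) (rank_list r 4)) @ added_list r"

lemma kept_and_removed:
  "distinct (filter (\<lambda>z. z \<notin> set (removed_list r)) (rank_list r 4) @ removed_list r)"
  "set (filter (\<lambda>z. z \<notin> set (removed_list r)) (rank_list r 4) @ removed_list r) = rank_set (young_power r) 4"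
  using distinct_removed_list removed_list_subset by auto

lemma length_swapped_blocks: "length (swapped_blocks r) + r div 3 = rank_size (young_power r) 4"
proof -
  have "length (filter (\<lambda>z. z \<notin> set (removed_list r)) (rank_list r 4)) + 13 * (r div 3) =
      rank_size (young_power r) 4"
    using distinct_card[OF kept_and_removed(1), of r] 
    unfolding kept_and_removed(2) by (simp add: rank_size_def length_removed_list)
  then show ?thesis by (simp add: swapped_blocks_def length_added_list)
qed

lemma swapped_blocks_common:
  "length (filter (\<lambda>B. x \<in> B \<and> y \<in> B) (swapped_blocks r)) =
   length (filter (\<lambda>B. x \<in> B \<and> y \<in> B)
     (map (lower r) (filter (\<lambda>z. z \<notin> set (removed_list r)) (rank_list r 4) @ removed_list r)))"
proof -
  have "length (filter (\<lambda>B. x \<in> B \<and> y \<in> B) (added_list r)) =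
      (\<Sum>t\<leftarrow>[0..<r div 3]. length (filter (\<lambda>B. x \<in> B \<and> y \<in> B)
        (map (\<lambda>B. shapes_tuple r t ` set B) added_blocks)))"
    unfolding added_list_def length_filter_concat by (simp add: comp_def)
  also have "\<dots> = (\<Sum>t\<leftarrow>[0..<r div 3]. length (filter (\<lambda>B. x \<in> B \<and> y \<in> B)
        (map (\<lambda>z. lower r (shapes_tuple r t z)) removed_elements)))"
    using swap_preserves_counts[OF block_of_three]
    by (intro arg_cong[where f = sum_list] map_cong refl) simp
  also have "\<dots> = length (filter (\<lambda>B. x \<in> B \<and> y \<in> B) (map (lower r) (removed_list r)))"
    unfolding removed_list_def map_concat length_filter_concat by (simp add: comp_def)
  finally show ?thesis by (simp add: swapped_blocks_def)
qed

lemma incidence_step_swapped: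
  "incidence_step r (young_tower r 3) (map (index_set (rank_list r 3)) (swapped_blocks r))"
proof (rule incidence_step_young_tower)
  fix B assume "B \<in> set (swapped_blocks r)"
  then consider z where "z \<in> rank_set (young_power r) 4" "B = lower r z"
    | t C where "t < r div 3" "C \<in> set added_blocks" "B = shapes_tuple r t ` set C"
    by (auto simp: swapped_blocks_def added_list_def)
  then show "B \<noteq> {} \<and> B \<subseteq> rank_set (young_power r) 3"
  proof cases
    case 1
    then show ?thesis using young_block[of z r 3] by simp
  next
    case 2
    then show ?thesis
      using added_blocks_valid[OF 2(2)] shapes_tuple_mem_rank_set[OF block_of_three[OF 2(1)]] by fastforce
  qed
next
  fix x y assume xy: "x \<in> rank_set (young_power r) 3" "y \<in> rank_set (young_power r) 3"
  show "length (filter (\<lambda>B. x \<in> B \<and> y \<in> B) (swapped_blocks r)) =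
      card (lower r x \<inter> lower r y) + (if x = y then r else 0)"
    unfolding swapped_blocks_common
    by (rule young_blocks_count[OF kept_and_removed(1) _ xy]) (simp only: kept_and_removed(2), simp)
qed

theorem exists_small_rank_4:
  assumes "0 < r"
  shows "\<exists>P :: nat ranked_order. differential_poset r P \<and> infinite (carrier P) \<and>
    (\<forall>i\<le>3. rank_size P i = rank_size (young_power r) i) \<and>
    rank_size P 4 + r div 3 = rank_size (young_power r) 4"
proof -
  let ?T = "(young_tower r)(4 := map (index_set (rank_list r 3)) (swapped_blocks r))"
  let ?R = "reflection_tower r 4 ?T"
  have T: "tower r ?R"
  proof (rule tower_reflection_tower)
    show "incidence_step r (?T n) (?T (Suc n))" if "n < 4" for n
      using that incidence_step_young[of r n] incidence_step_swapped[of r]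
      by (cases "n = 3") auto
  qed (use assms in \<open>simp_all add: young_tower_0\<close>)
  have "rank_size (tower_poset ?R) i = length (?T i)" if "i \<le> 4" for i
    using that by (simp add: rank_size_tower_poset reflection_tower.simps)
  then have "\<forall>i\<le>3. rank_size (tower_poset ?R) i = rank_size (young_power r) i"
    "rank_size (tower_poset ?R) 4 + r div 3 = rank_size (young_power r) 4"
    by (simp_all add: length_young_tower length_swapped_blocks)
  with tower.differential_poset_tower[OF T] tower.infinite_tower_poset[OF T] show ?thesis by blast
qed

theorem theorem1p2:
  shows "(\<exists>P :: nat \<Rightarrow> nat ranked_order.
      (\<forall>r\<ge>3. differential_poset r (P r) \<and> infinite (carrier (P r)) \<and>
         (\<forall>i\<le>3. rank_size (P r) i = rank_size (ranked_power young r) i) \<and>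
         int (rank_size (P r) 4) =
           int (rank_size (ranked_power young r) 4) - \<lfloor>real r / 3\<rfloor>) \<and>
      map (rank_size (P 3)) [0..<5] = [1, 3, 9, 22, 50]) \<and>
    (\<forall>r\<ge>3. real (rank_size (ranked_power young r) 4) =
       real r * (real r + 1) * ((real r)\<^sup>2 + 17 * real r + 42) / 24) \<and>
    map (rank_size (ranked_power young 3)) [0..<5] = [1, 3, 9, 22, 51]"
proof -
  have "\<forall>r. \<exists>P :: nat ranked_order. 3 \<le> r \<longrightarrow> differential_poset r P \<and> infinite (carrier P) \<and>
      (\<forall>i\<le>3. rank_size P i = rank_size (young_power r) i) \<and>
      rank_size P 4 + r div 3 = rank_size (young_power r) 4"
    using exists_small_rank_4 by (metis gr_zeroI not_numeral_le_zero)
  then obtain P :: "nat \<Rightarrow> nat ranked_order" where P: "\<And>r. 3 \<le> r \<Longrightarrow>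
      differential_poset r (P r) \<and> infinite (carrier (P r)) \<and>
      (\<forall>i\<le>3. rank_size (P r) i = rank_size (young_power r) i) \<and>
      rank_size (P r) 4 + r div 3 = rank_size (young_power r) 4"
    by (metis (lifting))
  have floor: "\<lfloor>real r / 3\<rfloor> = int (r div 3)" for r
    using floor_divide_of_nat_eq[of r 3] by simp
  have five: "[0..<5] = [0, 1, 2, 3, 4::nat]"
    by (simp add: upt_rec)
  have Y3: "rank_size (young_power 3) 0 = 1" "rank_size (young_power 3) 1 = 3"
    "rank_size (young_power 3) 2 = 9" "rank_size (young_power 3) 3 = 22"
    "rank_size (young_power 3) 4 = 51"
    using rank_size_young_power_small[of 3] by simp_all
  have P3: "rank_size (P 3) 0 = 1" "rank_size (P 3) 1 = 3" "rank_size (P 3) 2 = 9"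
    "rank_size (P 3) 3 = 22" "rank_size (P 3) 4 = 50"
    using P[of 3] Y3 by simp_all
  have "real (rank_size (young_power r) 4) =
      real r * (real r + 1) * ((real r)\<^sup>2 + 17 * real r + 42) / 24" for r
  proof -
    have "real (24 * rank_size (young_power r) 4) = real (r * (r + 1) * (r\<^sup>2 + 17 * r + 42))"
      by (simp only: rank_size_young_power_small(5))
    then show ?thesis by (simp add: field_simps)
  qed
  moreover have "int (rank_size (P r) 4) = int (rank_size (young_power r) 4) - \<lfloor>real r / 3\<rfloor>"
    if "3 \<le> r" for r
    using P[OF that] floor[of r] by linarith
  ultimately show ?thesis
    using P P3 Y3 by (intro conjI exI[of _ P] allI impI) (simp_all only: five list.map, simp_all)
qed

end
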